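(* Let $k$ be a field, $n\ge2$, $\rho\colon F_n\rtimes B_n\to\mathrm{GL}(V)$ a representation on an $N$-dimensional $k$-vector space, $g_j=\rho(x_j)$, $s_i=\rho(\sigma_i)$, $\lambda\in k^\times\setminus\{1\}$, $1\le i\le n-1$, $S_i:=\rho^{\mathrm{LM}}_\lambda(\sigma_i)$, and $E_\lambda:=\mathrm{Ker}(\lambda g_1\cdots g_n-I_N)$. The Artin action fixes the product of the generators, $\theta_{\sigma_i}(x_1\cdots x_n)=x_1\cdots x_n$; consequently $s_i$ commutes with $g_1\cdots g_n$ and preserves $E_\lambda$. The map $v=(v_1,\dots,v_n)^T\mapsto v_n$ is an isomorphism $L\to E_\lambda$ intertwining $S_i|_L$ with $s_i|_{E_\lambda}$. In particular $$\chi_{S_i|_L}(z)=\chi_{s_i|_{E_\lambda}}(z),$$ so every eigenvalue of $S_i|_L$ belongs to $\mathrm{spec}(s_i)$ (the subspace $L$ can only remove eigenvalues belonging to $\mathrm{spec}(s_i)$).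
   Context: $B_n$ is the Artin braid group with standard generators $\sigma_1,\dots,\sigma_{n-1}$; $F_n$ is the free group on $x_1,\dots,x_n$. The Artin action $\theta\colon B_n\to\mathrm{Aut}(F_n)$ is $\theta_{\sigma_i}(x_i)=x_{i+1}$, $\theta_{\sigma_i}(x_{i+1})=x_{i+1}^{-1}x_ix_{i+1}$, $\theta_{\sigma_i}(x_j)=x_j$ for $j\ne i,i+1$. $F_n\rtimes B_n$ is the corresponding semidirect product, in which $\sigma x\sigma^{-1}=\theta_\sigma(x)$. Twisted Long--Moody construction: for $\lambda\in k^\times$, $\rho^{\mathrm{LM}}_\lambda\colon F_n\rtimes B_n\to\mathrm{GL}(V^{\oplus n})$ is the representation given on generators as follows, in $n\times n$ block form with $N\times N$ blocks. $\rho^{\mathrm{LM}}_\lambda(x_i)$ is the identity matrix except in the $i$-th block row, which equals $(\lambda(g_1-1),\dots,\lambda(g_{i-1}-1),\lambda g_i,g_{i+1}-1,\dots,g_n-1)$. $\rho^{\mathrm{LM}}_\lambda(\sigma_i)=s_i^{\oplus n}\cdot\mathrm{diag}(I_{N(i-1)},R_i,I_{N(n-i-1)})$ with $R_i=\begin{pmatrix}O&g_i\\ I_N&I_N-g_{i+1}\end{pmatrix}$ in block rows and columns $i,i+1$. $L:=\bigcap_{j=1}^n\mathrm{Ker}(\rho^{\mathrm{LM}}_\lambda(x_j)-I_{Nn})\subseteq V^{\oplus n}$, which is invariant under $\rho^{\mathrm{LM}}_\lambda$. $\chi_A(z):=\det(zI-A)$; spectra are taken over an algebraic closure of $k$. 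*)

theory Defs
  imports
    "HOL-Algebra.Bij"
    "HOL-Algebra.Algebraic_Closure_Type"
    "Jordan_Normal_Form.Matrix_Kernel"
    "Jordan_Normal_Form.DL_Rank"
    "Jordan_Normal_Form.Spectral_Radius"
begin

section \<open>Groups given by generators and relations\<close>

text \<open>
  A word is a list of signed letters: \<open>(a, True)\<close> stands for the generator \<open>a\<close> and
  \<open>(a, False)\<close> for its formal inverse.
\<close>

type_synonym 'a word = "('a \<times> bool) list"

definition words :: "'a set \<Rightarrow> 'a word set" where
  "words Gs = lists (Gs \<times> UNIV)"

inductive pres_eq :: "'a set \<Rightarrow> ('a word \<times> 'a word) set \<Rightarrow> 'a word \<Rightarrow> 'a word \<Rightarrow> bool"
  for Gs R where
  refl: "pres_eq Gs R w w"
| sym: "pres_eq Gs R v w \<Longrightarrow> pres_eq Gs R w v"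
| trans: "pres_eq Gs R u v \<Longrightarrow> pres_eq Gs R v w \<Longrightarrow> pres_eq Gs R u w"
| cancel: "a \<in> Gs \<Longrightarrow> pres_eq Gs R (u @ [(a, b), (a, \<not> b)] @ v) (u @ v)"
| relator: "(l, r) \<in> R \<Longrightarrow> pres_eq Gs R (u @ l @ v) (u @ r @ v)"

definition pres_rel :: "'a set \<Rightarrow> ('a word \<times> 'a word) set \<Rightarrow> 'a word rel" where
  "pres_rel Gs R = {(v, w). v \<in> words Gs \<and> w \<in> words Gs \<and> pres_eq Gs R v w}"

text \<open>The group with generators \<open>Gs\<close> and relations \<open>l = r\<close> for \<open>(l, r) \<in> R\<close>.\<close>

definition presented_group ::
  "'a set \<Rightarrow> ('a word \<times> 'a word) set \<Rightarrow> 'a word set monoid" where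
  "presented_group Gs R = \<lparr>
     carrier = words Gs // pres_rel Gs R,
     monoid.mult = (\<lambda>A B. \<Union>v\<in>A. \<Union>w\<in>B. pres_rel Gs R `` {v @ w}),
     one = pres_rel Gs R `` {[]}\<rparr>"

definition pres_gen :: "'a set \<Rightarrow> ('a word \<times> 'a word) set \<Rightarrow> 'a \<Rightarrow> 'a word set" where
  "pres_gen Gs R a = pres_rel Gs R `` {[(a, True)]}"

definition eval_word :: "('g, 'b) monoid_scheme \<Rightarrow> ('a \<Rightarrow> 'g) \<Rightarrow> 'a word \<Rightarrow> 'g" where
  "eval_word G f w =
     foldr (\<lambda>(a, b) y. (if b then f a else inv\<^bsub>G\<^esub> (f a)) \<otimes>\<^bsub>G\<^esub> y) w \<one>\<^bsub>G\<^esub>"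

text \<open>
  The homomorphism from a presented group to the group \<open>G\<close> that sends each generator \<open>a\<close> to
  \<open>f a\<close>. It is well defined exactly when the elements \<open>f a\<close> satisfy the relations; then \<open>eval_word\<close>
  is constant on each class and \<open>the_elem\<close> picks this common value.
\<close>

definition pres_lift :: "('g, 'b) monoid_scheme \<Rightarrow> ('a \<Rightarrow> 'g) \<Rightarrow> 'a word set \<Rightarrow> 'g" where
  "pres_lift G f A = the_elem (eval_word G f ` A)"

definition list_mult :: "('g, 'b) monoid_scheme \<Rightarrow> 'g list \<Rightarrow> 'g" where
  "list_mult G xs = foldr (\<lambda>x y. x \<otimes>\<^bsub>G\<^esub> y) xs \<one>\<^bsub>G\<^esub>"


section \<open>Free groups, braid groups and the Artin action\<close>

definition free_group :: "nat \<Rightarrow> nat word set monoid" where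
  "free_group n = presented_group {1..n} {}"

definition free_gen :: "nat \<Rightarrow> nat \<Rightarrow> nat word set" where
  "free_gen n j = pres_gen {1..n} {} j"

definition braid_relations :: "nat \<Rightarrow> (nat word \<times> nat word) set" where
  "braid_relations n =
     {([(i, True), (Suc i, True), (i, True)], [(Suc i, True), (i, True), (Suc i, True)]) | i.
        1 \<le> i \<and> Suc i < n} \<union>
     {([(i, True), (j, True)], [(j, True), (i, True)]) | i j.
        1 \<le> i \<and> i < n \<and> 1 \<le> j \<and> j < n \<and> (i + 2 \<le> j \<or> j + 2 \<le> i)}"

definition braid_group :: "nat \<Rightarrow> nat word set monoid" where
  "braid_group n = presented_group {1..<n} (braid_relations n)"

definition braid_gen :: "nat \<Rightarrow> nat \<Rightarrow> nat word set" where
  "braid_gen n i = pres_gen {1..<n} (braid_relations n) i"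

definition artin_gen :: "nat \<Rightarrow> nat \<Rightarrow> nat word set \<Rightarrow> nat word set" where
  "artin_gen n i = restrict
     (pres_lift (free_group n)
       (\<lambda>j. if j = i then free_gen n (Suc i)
            else if j = Suc i then
              inv\<^bsub>free_group n\<^esub> (free_gen n (Suc i)) \<otimes>\<^bsub>free_group n\<^esub> free_gen n i
                \<otimes>\<^bsub>free_group n\<^esub> free_gen n (Suc i)
            else free_gen n j))
     (carrier (free_group n))"

definition artin_action :: "nat \<Rightarrow> nat word set \<Rightarrow> nat word set \<Rightarrow> nat word set" where
  "artin_action n = pres_lift (AutoGroup (free_group n)) (artin_gen n)"

text \<open>With this multiplication \<open>(\<one>, b) (x, \<one>) (\<one>, b)\<^sup>-\<^sup>1 = (\<phi> b x, \<one>)\<close>.\<close>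

definition semidirect ::
  "('x, 'c) monoid_scheme \<Rightarrow> ('h, 'd) monoid_scheme \<Rightarrow> ('h \<Rightarrow> 'x \<Rightarrow> 'x) \<Rightarrow> ('x \<times> 'h) monoid" where
  "semidirect K H \<phi> = \<lparr>
     carrier = carrier K \<times> carrier H,
     monoid.mult = (\<lambda>(x, b) (y, c). (x \<otimes>\<^bsub>K\<^esub> \<phi> b y, b \<otimes>\<^bsub>H\<^esub> c)),
     one = (\<one>\<^bsub>K\<^esub>, \<one>\<^bsub>H\<^esub>)\<rparr>"

definition free_braid :: "nat \<Rightarrow> (nat word set \<times> nat word set) monoid" where
  "free_braid n = semidirect (free_group n) (braid_group n) (artin_action n)"

definition fb_x :: "nat \<Rightarrow> nat \<Rightarrow> nat word set \<times> nat word set" where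
  "fb_x n j = (free_gen n j, \<one>\<^bsub>braid_group n\<^esub>)"

definition fb_sigma :: "nat \<Rightarrow> nat \<Rightarrow> nat word set \<times> nat word set" where
  "fb_sigma n i = (\<one>\<^bsub>free_group n\<^esub>, braid_gen n i)"


section \<open>The twisted Long--Moody construction\<close>

definition GL :: "'k :: field itself \<Rightarrow> nat \<Rightarrow> 'k mat monoid" where
  "GL ty N = units_of (ring_mat ty N ())"

text \<open>
  Generators are indexed from 1, matrix entries from 0: block \<open>(p, q)\<close> with \<open>p, q \<in> {1..n}\<close> occupies
  the rows \<open>(p - 1) N, \<dots>, p N - 1\<close> and the columns \<open>(q - 1) N, \<dots>, q N - 1\<close>.
\<close>

definition block_mat :: "nat \<Rightarrow> nat \<Rightarrow> (nat \<Rightarrow> nat \<Rightarrow> 'k mat) \<Rightarrow> 'k mat" where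
  "block_mat n N B =
     mat (n * N) (n * N) (\<lambda>(a, b). B (Suc (a div N)) (Suc (b div N)) $$ (a mod N, b mod N))"

definition block_vec :: "nat \<Rightarrow> nat \<Rightarrow> 'k vec \<Rightarrow> 'k vec" where
  "block_vec N p v = vec N (\<lambda>a. v $ ((p - 1) * N + a))"

definition lm_x :: "nat \<Rightarrow> nat \<Rightarrow> 'k :: field \<Rightarrow> (nat \<Rightarrow> 'k mat) \<Rightarrow> nat \<Rightarrow> 'k mat" where
  "lm_x n N lam g i = block_mat n N
     (\<lambda>p q. if p = i then
               if q < i then lam \<cdot>\<^sub>m (g q - 1\<^sub>m N)
               else if q = i then lam \<cdot>\<^sub>m g q
               else g q - 1\<^sub>m N
             else if p = q then 1\<^sub>m N else 0\<^sub>m N N)"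

definition lm_sigma ::
  "nat \<Rightarrow> nat \<Rightarrow> (nat \<Rightarrow> 'k :: field mat) \<Rightarrow> (nat \<Rightarrow> 'k mat) \<Rightarrow> nat \<Rightarrow> 'k mat" where
  "lm_sigma n N g s i =
     diag_block_mat (replicate n (s i)) *
     diag_block_mat
       [1\<^sub>m (N * (i - 1)),
        four_block_mat (0\<^sub>m N N) (g i) (1\<^sub>m N) (1\<^sub>m N - g (Suc i)),
        1\<^sub>m (N * (n - i - 1))]"

text \<open>
  As \<open>(x, b) = (x, \<one>) (\<one>, b)\<close>, a representation of the semidirect product is determined by its
  values on the generators.
\<close>

definition long_moody ::
  "nat \<Rightarrow> nat \<Rightarrow> (nat word set \<times> nat word set \<Rightarrow> 'k :: field mat) \<Rightarrow> 'k \<Rightarrow>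
   nat word set \<times> nat word set \<Rightarrow> 'k mat" where
  "long_moody n N rho lam = (\<lambda>(x, b).
     pres_lift (GL TYPE('k) (n * N)) (lm_x n N lam (\<lambda>j. rho (fb_x n j))) x
     \<otimes>\<^bsub>GL TYPE('k) (n * N)\<^esub>
     pres_lift (GL TYPE('k) (n * N))
       (lm_sigma n N (\<lambda>j. rho (fb_x n j)) (\<lambda>i. rho (fb_sigma n i))) b)"

definition lm_fixed ::
  "nat \<Rightarrow> nat \<Rightarrow> (nat word set \<times> nat word set \<Rightarrow> 'k :: field mat) \<Rightarrow> 'k \<Rightarrow> 'k vec set" where
  "lm_fixed n N rho lam =
     (\<Inter>j\<in>{1..n}. mat_kernel (long_moody n N rho lam (fb_x n j) - 1\<^sub>m (n * N)))"


section \<open>Restriction of a matrix to an invariant subspace\<close>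

definition subspace_of :: "nat \<Rightarrow> 'k :: field vec set \<Rightarrow> ('k, 'k vec) module" where
  "subspace_of m W = (module_vec TYPE('k) m)\<lparr>carrier := W\<rparr>"

text \<open>
  \<open>M\<close> is the matrix, with respect to some ordered basis of \<open>W\<close>, of the endomorphism \<open>v \<mapsto> A v\<close> of the
  \<open>A\<close>-invariant subspace \<open>W\<close> of \<open>k\<^sup>m\<close>.
\<close>

definition is_restr_mat :: "nat \<Rightarrow> 'k :: field mat \<Rightarrow> 'k vec set \<Rightarrow> 'k mat \<Rightarrow> bool" where
  "is_restr_mat m A W M \<longleftrightarrow>
     (\<exists>bs. distinct bs \<and> set bs \<subseteq> W \<and>
           vectorspace.basis class_ring (subspace_of m W) (set bs) \<and>
           M \<in> carrier_mat (length bs) (length bs) \<and>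
           A * mat_of_cols m bs = mat_of_cols m bs * M)"

definition restr_mat :: "nat \<Rightarrow> 'k :: field mat \<Rightarrow> 'k vec set \<Rightarrow> 'k mat" where
  "restr_mat m A W = (SOME M. is_restr_mat m A W M)"

text \<open>Spectrum over an algebraic closure.\<close>

definition ac_spectrum :: "'k :: field mat \<Rightarrow> 'k alg_closure set" where
  "ac_spectrum A = spectrum (map_mat to_ac A)"

text \<open>
  For a subspace \<open>W\<close> invariant under \<open>A\<close> such a matrix exists, and any two are similar. Hence the
  choice made in \<open>restr_mat\<close> affects neither the characteristic polynomial nor the spectrum.
\<close>

lemma basis_coordinates:
  fixes W :: "'k :: field vec set"
  assumes sub: "subspace class_ring W (module_vec TYPE('k) m)"
    and bs: "distinct bs" "set bs \<subseteq> W" "vectorspace.basis class_ring (subspace_of m W) (set bs)"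
  shows "set bs \<subseteq> carrier_vec m"
    and "w \<in> W \<Longrightarrow> \<exists>c \<in> carrier_vec (length bs). mat_of_cols m bs *\<^sub>v c = w"
    and "c \<in> carrier_vec (length bs) \<Longrightarrow> mat_of_cols m bs *\<^sub>v c = 0\<^sub>v m \<Longrightarrow> c = 0\<^sub>v (length bs)"
proof -
  interpret vec_space "TYPE('k)" m .
  have W: "submodule class_ring W V" using sub by (simp add: subspace_def)
  have vsW: "vectorspace class_ring (vs W)" using sub by (rule subspace_is_vs)
  have *: "subspace_of m W = vs W" by (simp add: subspace_of_def)
  have sp: "span (set bs) = W" and li: "lin_indpt (set bs)"
    using bs(3) span_li_not_depend[OF bs(2) W]
    unfolding * vectorspace.basis_def[OF vsW] by auto
  show c: "set bs \<subseteq> carrier_vec m" using bs(2) submodule.subset[OF W] by (auto simp: module_vec_simps)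
  have cols: "cols (mat_of_cols m bs) = bs" using c by simp
  show "\<exists>c \<in> carrier_vec (length bs). mat_of_cols m bs *\<^sub>v c = w" if "w \<in> W"
    using that col_space_eq[of "mat_of_cols m bs" "length bs"]
    by (auto simp: col_space_def cols sp)
  show "c = 0\<^sub>v (length bs)" if "c \<in> carrier_vec (length bs)" "mat_of_cols m bs *\<^sub>v c = 0\<^sub>v m"
    using lin_depI[of "mat_of_cols m bs" "length bs" c] that li bs(1) by (auto simp: cols)
qed

lemma factor_through:
  fixes P :: "'k :: field mat"
  assumes P: "P \<in> carrier_mat m d" and Q: "Q \<in> carrier_mat m e"
    and "\<And>j. j < e \<Longrightarrow> \<exists>c \<in> carrier_vec d. P *\<^sub>v c = col Q j"
  shows "\<exists>C \<in> carrier_mat d e. P * C = Q"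
proof -
  obtain f where f: "\<And>j. j < e \<Longrightarrow> f j \<in> carrier_vec d \<and> P *\<^sub>v f j = col Q j" using assms(3) by metis
  let ?C = "mat_of_cols d (map f [0..<e])"
  have C: "?C \<in> carrier_mat d e" using mat_of_cols_carrier(1)[of d "map f [0..<e]"] by simp
  have "P * ?C = Q"
  proof (rule mat_col_eqI)
    fix j assume "j < dim_col Q"
    then have j: "j < e" using Q by simp
    have "col (P * ?C) j = P *\<^sub>v col ?C j" using col_mult2[OF P C j] .
    also have "col ?C j = f j" using j f by (subst col_mat_of_cols) auto
    finally show "col (P * ?C) j = col Q j" using f j by simp
  qed (use P Q C in auto)
  then show ?thesis using C by blast
qed

lemma cancel_injective:
  fixes P :: "'k :: field mat"
  assumes P: "P \<in> carrier_mat m d" and inj: "\<And>c. c \<in> carrier_vec d \<Longrightarrow> P *\<^sub>v c = 0\<^sub>v m \<Longrightarrow> c = 0\<^sub>v d"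
    and C: "C \<in> carrier_mat d e" and D: "D \<in> carrier_mat d e" and eq: "P * C = P * D"
  shows "C = D"
proof (rule mat_col_eqI)
  fix j assume "j < dim_col D"
  then have j: "j < e" using D by simp
  have "P *\<^sub>v col C j = P *\<^sub>v col D j" using col_mult2[OF P C j] col_mult2[OF P D j] eq by simp
  then have "P *\<^sub>v (col C j - col D j) = 0\<^sub>v m"
    using P C D j by (subst mult_minus_distrib_mat_vec[OF P]) auto
  then have z: "col C j - col D j = 0\<^sub>v d"
    using inj[OF minus_carrier_vec[OF col_carrier_vec[OF j C] col_carrier_vec[OF j D]]] by simp
  show "col C j = col D j"
  proof (rule eq_vecI)
    fix i assume i: "i < dim_vec (col D j)"
    have "(col C j - col D j) $ i = 0" using z i D by simp
    then show "col C j $ i = col D j $ i" using i C D by simp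
  qed (use C D in auto)
qed (use C D in auto)

lemma is_restr_mat_similar:
  fixes A :: "'k :: field mat"
  assumes A: "A \<in> carrier_mat m m" and sub: "subspace class_ring W (module_vec TYPE('k) m)"
    and M: "is_restr_mat m A W M" and M': "is_restr_mat m A W M'"
  shows "similar_mat M M'"
proof -
  obtain bs where bs: "distinct bs" "set bs \<subseteq> W" "vectorspace.basis class_ring (subspace_of m W) (set bs)"
    "M \<in> carrier_mat (length bs) (length bs)" "A * mat_of_cols m bs = mat_of_cols m bs * M"
    using M unfolding is_restr_mat_def by auto
  obtain cs where cs: "distinct cs" "set cs \<subseteq> W" "vectorspace.basis class_ring (subspace_of m W) (set cs)"
    "M' \<in> carrier_mat (length cs) (length cs)" "A * mat_of_cols m cs = mat_of_cols m cs * M'"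
    using M' unfolding is_restr_mat_def by auto
  note b = basis_coordinates[OF sub bs(1-3)]
  note c = basis_coordinates[OF sub cs(1-3)]
  define P where "P = mat_of_cols m bs"
  define Q where "Q = mat_of_cols m cs"
  have len: "length bs = length cs"
  proof -
    interpret vec_space "TYPE('k)" m .
    have vsW: "vectorspace class_ring (subspace_of m W)"
      using subspace_is_vs[OF sub] by (simp add: subspace_of_def)
    show ?thesis
      using vectorspace.dim_basis[OF vsW _ bs(3)] vectorspace.dim_basis[OF vsW _ cs(3)] bs(1) cs(1)
      by (simp add: distinct_card)
  qed
  let ?d = "length bs"
  have P: "P \<in> carrier_mat m ?d" and Q: "Q \<in> carrier_mat m ?d"
    using mat_of_cols_carrier(1)[of m] by (auto simp: P_def Q_def len)
  have colP: "col P j \<in> W" if "j < ?d" for j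
    using that bs(2) b(1) by (auto simp: P_def col_mat_of_cols subset_iff)
  have colQ: "col Q j \<in> W" if "j < ?d" for j
    using that cs(2) c(1) by (auto simp: Q_def col_mat_of_cols subset_iff len)
  obtain C where C: "C \<in> carrier_mat ?d ?d" "P * C = Q"
    using factor_through[OF P Q] b(2) colQ by (auto simp: P_def)
  obtain D where D: "D \<in> carrier_mat ?d ?d" "Q * D = P"
    using factor_through[OF Q P] c(2) colP by (auto simp: Q_def len)
  have injP: "x \<in> carrier_vec ?d \<Longrightarrow> P *\<^sub>v x = 0\<^sub>v m \<Longrightarrow> x = 0\<^sub>v ?d" for x
    using b(3) by (simp add: P_def)
  have "P * (C * D) = P * 1\<^sub>m ?d" using assoc_mult_mat[OF P C(1) D(1)] C(2) D(2) right_mult_one_mat[OF P] by simp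
  then have CD: "C * D = 1\<^sub>m ?d"
    using cancel_injective[OF P injP mult_carrier_mat[OF C(1) D(1)] one_carrier_mat] by blast
  have DC: "D * C = 1\<^sub>m ?d" using mat_mult_left_right_inverse[OF C(1) D(1) CD] .
  have M: "M \<in> carrier_mat ?d ?d" and M': "M' \<in> carrier_mat ?d ?d" using bs(4) cs(4) len by auto
  have "P * M = A * P" using bs(5) by (simp add: P_def)
  also have "\<dots> = A * Q * D" using assoc_mult_mat[OF A Q D(1)] D(2) by simp
  also have "\<dots> = Q * M' * D" using cs(5) by (simp add: Q_def)
  also have "\<dots> = P * C * M' * D" using C by simp
  also have "\<dots> = P * (C * M' * D)"
    by (simp only: assoc_mult_mat[OF P C(1) M'] assoc_mult_mat[OF P mult_carrier_mat[OF C(1) M'] D(1)])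
  finally have "M = C * M' * D"
    using cancel_injective[OF P injP M mult_carrier_mat[OF mult_carrier_mat[OF C(1) M'] D(1)]] by blast
  then show ?thesis using similar_matI[OF _ CD DC] C(1) D(1) M M' by blast
qed

lemma is_restr_mat_exists:
  fixes A :: "'k :: field mat"
  assumes A: "A \<in> carrier_mat m m" and sub: "subspace class_ring W (module_vec TYPE('k) m)"
    and inv: "\<And>v. v \<in> W \<Longrightarrow> A *\<^sub>v v \<in> W"
  shows "\<exists>M. is_restr_mat m A W M"
proof -
  interpret vec_space "TYPE('k)" m .
  have W: "submodule class_ring W V" using sub by (simp add: subspace_def)
  have Wc: "W \<subseteq> carrier V" using submodule.subset[OF W] .
  have vsW: "vectorspace class_ring (vs W)" using sub by (rule subspace_is_vs)
  have *: "subspace_of m W = vs W" by (simp add: subspace_of_def)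
  define I where "I k \<longleftrightarrow> (\<exists>B. finite B \<and> B \<subseteq> W \<and> lin_indpt B \<and> card B = k)" for k
  have bound: "I k \<Longrightarrow> k \<le> m" for k
    using li_le_dim(2)[OF fin_dim] Wc dim_is_n unfolding I_def by auto
  have "I 0" unfolding I_def by (intro exI[of _ "{}"]) (auto simp: lin_dep_def)
  then obtain k where k: "I k" "\<And>l. I l \<Longrightarrow> l \<le> k"
    using GreatestI_nat[of I 0 m, OF _ bound] Greatest_le_nat[of I _ m, OF _ bound] by blast
  obtain B where B: "finite B" "B \<subseteq> W" "lin_indpt B" "card B = k" using k(1) unfolding I_def by auto
  have li: "LinearCombinations.module.lin_dep class_ring (vs W) S = lin_dep S" if "S \<subseteq> W" for S
    using span_li_not_depend(2)[OF that W] .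
  have "maximal B (\<lambda>S. S \<subseteq> carrier (vs W) \<and> \<not> LinearCombinations.module.lin_dep class_ring (vs W) S)"
    unfolding maximal_def
  proof (intro conjI allI impI)
    fix T assume T: "B \<subseteq> T \<and> T \<subseteq> carrier (vs W) \<and> \<not> LinearCombinations.module.lin_dep class_ring (vs W) T"
    then have TW: "T \<subseteq> W" "lin_indpt T" using li by auto
    have "finite T" using fin_dim_li_fin[OF fin_dim TW(2)] TW(1) Wc by auto
    then have "card T \<le> card B" using k(2)[of "card T"] TW B(4) unfolding I_def by blast
    then show "T = B" using T \<open>finite T\<close> card_seteq by blast
  qed (use B li in auto)
  then have bas: "vectorspace.basis class_ring (vs W) B"
    using vectorspace.max_li_is_basis[OF vsW] by blast
  obtain bs where bs: "set bs = B" "distinct bs" using finite_distinct_list[OF B(1)] by auto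
  have pre: "distinct bs" "set bs \<subseteq> W" "vectorspace.basis class_ring (subspace_of m W) (set bs)"
    using bs B bas by (auto simp: *)
  note b = basis_coordinates[OF sub pre]
  let ?P = "mat_of_cols m bs"
  have P: "?P \<in> carrier_mat m (length bs)" by simp
  have "\<exists>M \<in> carrier_mat (length bs) (length bs). ?P * M = A * ?P"
  proof (rule factor_through[OF P])
    fix j assume j: "j < length bs"
    have "col (A * ?P) j = A *\<^sub>v (bs ! j)"
      using col_mult2[OF A P j] j b(1) by (simp add: col_mat_of_cols subset_iff)
    also have "\<dots> \<in> W" using inv[of "bs ! j"] pre(2) nth_mem[OF j] by blast
    finally show "\<exists>c\<in>carrier_vec (length bs). ?P *\<^sub>v c = col (A * ?P) j" using b(2) by blast
  qed (use A in auto)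
  then obtain M where M: "M \<in> carrier_mat (length bs) (length bs)" "?P * M = A * ?P" by blast
  show ?thesis unfolding is_restr_mat_def
    by (rule exI[of _ M], rule exI[of _ bs], intro conjI pre M(1) M(2)[symmetric])
qed

corollary char_poly_restr_mat:
  fixes A :: "'k :: field mat"
  assumes "A \<in> carrier_mat m m" "subspace class_ring W (module_vec TYPE('k) m)" "is_restr_mat m A W M"
  shows "char_poly (restr_mat m A W) = char_poly M"
  unfolding restr_mat_def
  by (rule char_poly_similar, rule is_restr_mat_similar[OF assms(1,2) _ assms(3)],
      rule someI[of "is_restr_mat m A W", OF assms(3)])

end

theory Submission
  imports Defs
begin

text \<open>
  Why the theorem holds. A vector \<open>v = (v\<^sub>1, \<dots>, v\<^sub>n)\<close> is fixed by the \<open>j\<close>-th Long--Moody matrix exactly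
  when one linear equation \<open>T\<^sub>j = v\<^sub>j\<close> between its blocks holds, since that matrix differs from the
  identity only in block row \<open>j\<close>. Subtracting neighbouring equations, almost everything cancels:
  what remains is \<open>(\<lambda> - 1) (v\<^sub>j - g\<^sub>j\<^sub>+\<^sub>1 v\<^sub>j\<^sub>+\<^sub>1) = 0\<close>. As \<open>\<lambda> \<noteq> 1\<close>, this gives
  \<open>v\<^sub>j = g\<^sub>j\<^sub>+\<^sub>1 v\<^sub>j\<^sub>+\<^sub>1\<close>, and then the last equation telescopes to \<open>\<lambda> g\<^sub>1 v\<^sub>1 = v\<^sub>n\<close>
  (lemmas \<open>telescoped_system\<close> and \<open>xi_fixed_iff\<close>). So a common fixed vector is determined by its
  last block, \<open>v\<^sub>j = g\<^sub>j\<^sub>+\<^sub>1 \<cdots> g\<^sub>n v\<^sub>n\<close>, and the only condition on \<open>v\<^sub>n\<close> is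
  \<open>\<lambda> g\<^sub>1 \<cdots> g\<^sub>n v\<^sub>n = v\<^sub>n\<close> (lemma \<open>bij_betw_last_block\<close>).

  On such a vector the crossing block of \<open>\<sigma>\<^sub>i\<close> degenerates: the entry \<open>v\<^sub>i + v\<^sub>i\<^sub>+\<^sub>1 - g\<^sub>i\<^sub>+\<^sub>1 v\<^sub>i\<^sub>+\<^sub>1\<close>
  is just \<open>v\<^sub>i\<^sub>+\<^sub>1\<close>. Hence \<open>\<sigma>\<^sub>i\<close> applies \<open>s\<^sub>i\<close> to every block except the \<open>i\<close>-th, in particular to
  the last one, and the relations between \<open>s\<^sub>i\<close> and the \<open>g\<^sub>j\<close> that hold in the semidirect product
  show that the image is again fixed (lemma \<open>sigma_common_fixed\<close>). An injective intertwiner carries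
  a basis with its matrix to a basis with the same matrix, so the two restrictions have a common
  matrix (lemma \<open>is_restr_mat_transport\<close>). This matrix \<open>M\<close> satisfies \<open>s\<^sub>i P = P M\<close> with \<open>P\<close> having
  independent columns; a left inverse of \<open>P\<close> survives the passage to the algebraic closure, so
  eigenvectors of \<open>M\<close> there are mapped to eigenvectors of \<open>s\<^sub>i\<close> (lemma \<open>ac_spectrum_restr_mat\<close>).

  Much of the work lies in identifying the objects. Groups are given by presentations, so a
  homomorphism prescribed on generators takes the prescribed values only once the relations have
  been verified. This is needed for the Artin automorphisms (lemmas \<open>artin_gen_far\<close> and
  \<open>artin_gen_adjacent\<close>) and for the Long--Moody matrices of the braid generators
  (lemmas \<open>sigma_far\<close> and \<open>sigma_adjacent\<close>).
\<close>

section \<open>Groups given by generators and relations\<close>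

lemma words_Nil [simp]: "[] \<in> words Gs"
  by (simp add: words_def)

lemma words_Cons [simp]: "(a, b) # w \<in> words Gs \<longleftrightarrow> a \<in> Gs \<and> w \<in> words Gs"
  by (auto simp: words_def)

lemma words_append [simp]: "v @ w \<in> words Gs \<longleftrightarrow> v \<in> words Gs \<and> w \<in> words Gs"
  by (auto simp: words_def)

lemma eval_word_Nil [simp]: "eval_word G f [] = \<one>\<^bsub>G\<^esub>"
  by (simp add: eval_word_def)

lemma eval_word_Cons [simp]:
  "eval_word G f ((a, b) # w) = (if b then f a else inv\<^bsub>G\<^esub> (f a)) \<otimes>\<^bsub>G\<^esub> eval_word G f w"
  by (simp add: eval_word_def)

context group
begin

lemma eval_word_closed [simp]:
  assumes f: "\<And>a. a \<in> Gs \<Longrightarrow> f a \<in> carrier G" and "w \<in> words Gs"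
  shows "eval_word G f w \<in> carrier G"
  using assms(2) by (induction w) (auto simp: f)

lemma eval_word_append:
  assumes f: "\<And>a. a \<in> Gs \<Longrightarrow> f a \<in> carrier G" and "v \<in> words Gs" "w \<in> words Gs"
  shows "eval_word G f (v @ w) = eval_word G f v \<otimes> eval_word G f w"
  using assms(2) by (induction v) (auto simp: f assms(3) eval_word_closed[of Gs] m_assoc)

lemma eval_word_cong:
  assumes "\<And>a. a \<in> Gs \<Longrightarrow> f a = h a" and "w \<in> words Gs"
  shows "eval_word G f w = eval_word G h w"
  using assms(2) by (induction w) (auto simp: assms(1))

end

lemma hom_eval_word:
  assumes h: "h \<in> hom P H" and P: "group P" and H: "group H"
    and f: "\<And>a. a \<in> Gs \<Longrightarrow> f a \<in> carrier P" and w: "w \<in> words Gs"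
  shows "h (eval_word P f w) = eval_word H (\<lambda>a. h (f a)) w"
proof -
  interpret group_hom P H h using h P H by (simp add: group_hom_def group_hom_axioms_def)
  show ?thesis using w by (induction w) (auto simp: f G.eval_word_closed[of Gs])
qed

text \<open>
  The relators have to be words in the generators: only then does the congruence \<open>pres_eq\<close>, which
  lives on all lists, never lead from a word in the generators to a list outside \<open>words Gs\<close>.
\<close>

locale presentation =
  fixes Gs :: "'a set" and R :: "('a word \<times> 'a word) set"
  assumes relators: "R \<subseteq> words Gs \<times> words Gs"
begin

abbreviation cls :: "'a word \<Rightarrow> 'a word set" where
  "cls w \<equiv> pres_rel Gs R `` {w}"

abbreviation P :: "'a word set monoid" where
  "P \<equiv> presented_group Gs R"

lemma pres_eq_words: "pres_eq Gs R v w \<Longrightarrow> v \<in> words Gs \<longleftrightarrow> w \<in> words Gs"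
  by (induction rule: pres_eq.induct) (use relators in auto)

lemma equiv_pres_rel: "equiv (words Gs) (pres_rel Gs R)"
  by (rule equivI)
    (auto simp: pres_rel_def refl_on_def sym_def trans_def
      intro: pres_eq.refl pres_eq.sym pres_eq.trans)

lemma pres_eq_context: "pres_eq Gs R v w \<Longrightarrow> pres_eq Gs R (x @ v @ y) (x @ w @ y)"
proof (induction rule: pres_eq.induct)
  case (cancel a u b v)
  from pres_eq.cancel[OF cancel, of R "x @ u" b "v @ y"] show ?case by simp
next
  case (relator l r u v)
  from pres_eq.relator[OF relator, of Gs "x @ u" "v @ y"] show ?case by simp
qed (auto intro: pres_eq.refl pres_eq.sym pres_eq.trans)

lemma pres_eq_append:
  "pres_eq Gs R v v' \<Longrightarrow> pres_eq Gs R w w' \<Longrightarrow> pres_eq Gs R (v @ w) (v' @ w')"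
  using pres_eq_context[of v v' "[]" w] pres_eq_context[of w w' v' "[]"]
  by (auto intro: pres_eq.trans)

lemma cls_eqI: "pres_eq Gs R v w \<Longrightarrow> v \<in> words Gs \<Longrightarrow> cls v = cls w"
  by (rule equiv_class_eq[OF equiv_pres_rel]) (auto simp: pres_rel_def pres_eq_words)

lemma carrier_P: "carrier P = {cls w | w. w \<in> words Gs}"
  by (auto simp: presented_group_def quotient_def)

lemma cls_carrier [simp]: "w \<in> words Gs \<Longrightarrow> cls w \<in> carrier P"
  by (auto simp: carrier_P)

lemma one_P: "\<one>\<^bsub>P\<^esub> = cls []"
  by (simp add: presented_group_def)

lemma mult_P:
  assumes "v \<in> words Gs" "w \<in> words Gs"
  shows "cls v \<otimes>\<^bsub>P\<^esub> cls w = cls (v @ w)"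
proof -
  have "congruent2 (pres_rel Gs R) (pres_rel Gs R) (\<lambda>v w. cls (v @ w))"
  proof (rule congruent2I')
    fix v v' w w' assume "(v, v') \<in> pres_rel Gs R" "(w, w') \<in> pres_rel Gs R"
    then show "cls (v @ w) = cls (v' @ w')"
      by (intro cls_eqI pres_eq_append) (auto simp: pres_rel_def)
  qed
  from UN_equiv_class2[OF equiv_pres_rel equiv_pres_rel this assms]
  show ?thesis by (simp add: presented_group_def)
qed

text \<open>
  Letters are cancelled from the inside out: an inverse of the tail, followed by the inverse
  of the head letter, is a left inverse of the whole word.
\<close>

lemma word_inverse:
  assumes "w \<in> words Gs"
  shows "\<exists>w' \<in> words Gs. pres_eq Gs R (w' @ w) []"
  using assms
proof (induction w)
  case (Cons x w)
  obtain a b where x: "x = (a, b)" by force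
  from Cons obtain w' where w': "w' \<in> words Gs" "pres_eq Gs R (w' @ w) []" by (auto simp: x)
  have "pres_eq Gs R (w' @ [(a, \<not> b), (a, \<not> \<not> b)] @ w) (w' @ w)"
    by (rule pres_eq.cancel) (use Cons x in auto)
  then have "pres_eq Gs R ((w' @ [(a, \<not> b)]) @ x # w) []"
    using pres_eq.trans w'(2) by (fastforce simp: x)
  then show ?case using w'(1) Cons.prems by (intro bexI[of _ "w' @ [(a, \<not> b)]"]) (auto simp: x)
qed (auto intro!: bexI[of _ "[]"] pres_eq.refl)

sublocale group P
proof (rule groupI)
  fix x assume "x \<in> carrier P"
  then obtain w where w: "w \<in> words Gs" "x = cls w" by (auto simp: carrier_P)
  obtain w' where "w' \<in> words Gs" "pres_eq Gs R (w' @ w) []" using word_inverse[OF w(1)] by auto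
  then show "\<exists>y\<in>carrier P. y \<otimes>\<^bsub>P\<^esub> x = \<one>\<^bsub>P\<^esub>"
    using w by (intro bexI[of _ "cls w'"]) (auto simp: mult_P one_P intro!: cls_eqI)
next
  fix x y assume "x \<in> carrier P" "y \<in> carrier P"
  then obtain v w where "v \<in> words Gs" "w \<in> words Gs" "x = cls v" "y = cls w"
    by (auto simp: carrier_P)
  then show "x \<otimes>\<^bsub>P\<^esub> y \<in> carrier P" by (simp add: mult_P)
next
  fix x y z assume "x \<in> carrier P" "y \<in> carrier P" "z \<in> carrier P"
  then obtain u v w where "u \<in> words Gs" "v \<in> words Gs" "w \<in> words Gs"
    "x = cls u" "y = cls v" "z = cls w"
    by (auto simp: carrier_P)
  then show "x \<otimes>\<^bsub>P\<^esub> y \<otimes>\<^bsub>P\<^esub> z = x \<otimes>\<^bsub>P\<^esub> (y \<otimes>\<^bsub>P\<^esub> z)" by (simp add: mult_P)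
next
  fix x assume "x \<in> carrier P"
  then obtain w where "w \<in> words Gs" "x = cls w" by (auto simp: carrier_P)
  then show "\<one>\<^bsub>P\<^esub> \<otimes>\<^bsub>P\<^esub> x = x" by (simp add: mult_P one_P)
qed (simp add: one_P)

abbreviation gen :: "'a \<Rightarrow> 'a word set" where
  "gen \<equiv> pres_gen Gs R"

lemma gen_carrier [simp]: "a \<in> Gs \<Longrightarrow> gen a \<in> carrier P"
  by (auto simp: pres_gen_def)

lemma inv_gen:
  assumes "a \<in> Gs"
  shows "inv\<^bsub>P\<^esub> (gen a) = cls [(a, False)]"
proof (rule inv_equality)
  have "pres_eq Gs R ([] @ [(a, False), (a, \<not> False)] @ []) ([] @ [])"
    by (rule pres_eq.cancel) fact
  then show "cls [(a, False)] \<otimes>\<^bsub>P\<^esub> gen a = \<one>\<^bsub>P\<^esub>"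
    using assms by (auto simp: pres_gen_def mult_P one_P intro!: cls_eqI)
qed (use assms in \<open>auto simp: pres_gen_def\<close>)

lemma eval_word_gen:
  assumes "w \<in> words Gs"
  shows "eval_word P gen w = cls w"
  using assms
proof (induction w)
  case (Cons x w)
  obtain a b where x: "x = (a, b)" by force
  have "(if b then gen a else inv\<^bsub>P\<^esub> (gen a)) = cls [(a, b)]"
    using Cons by (cases b) (simp add: pres_gen_def, simp add: x inv_gen)
  then show ?case using Cons by (simp add: x mult_P)
qed (simp add: one_P)

lemma eval_word_relator:
  assumes "(l, r) \<in> R"
  shows "eval_word P gen l = eval_word P gen r"
proof -
  have "cls l = cls r"
    by (rule cls_eqI) (use assms relators pres_eq.relator[OF assms, of Gs "[]" "[]"] in auto)
  then show ?thesis using assms relators by (auto simp: eval_word_gen)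
qed

text \<open>
  The generators generate, since every class is the value of a word in them. This is how two
  endomorphisms of a free group are compared below.
\<close>

lemma hom_eqI:
  assumes "h \<in> hom P H" "h' \<in> hom P H" "group H" "\<And>a. a \<in> Gs \<Longrightarrow> h (gen a) = h' (gen a)"
    and "x \<in> carrier P"
  shows "h x = h' x"
proof -
  obtain w where w: "w \<in> words Gs" "x = cls w" using assms(5) by (auto simp: carrier_P)
  have "eval_word H (\<lambda>a. h (gen a)) w = eval_word H (\<lambda>a. h' (gen a)) w"
    using group.eval_word_cong[OF assms(3), of Gs "\<lambda>a. h (gen a)" "\<lambda>a. h' (gen a)"] assms(4) w(1)
    by blast
  then show ?thesis
    using hom_eval_word[where f = gen, OF assms(1) is_group assms(3) gen_carrier w(1)]
      hom_eval_word[where f = gen, OF assms(2) is_group assms(3) gen_carrier w(1)]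
      eval_word_gen[OF w(1)] w(2)
    by simp
qed

end

text \<open>
  The universal property: values on generators that respect the relators extend to a homomorphism.
\<close>

locale presentation_hom = presentation Gs R + H: group H
  for Gs :: "'a set" and R and H (structure) +
  fixes f :: "'a \<Rightarrow> 'b"
  assumes f_closed: "\<And>a. a \<in> Gs \<Longrightarrow> f a \<in> carrier H"
    and f_relators: "\<And>l r. (l, r) \<in> R \<Longrightarrow> eval_word H f l = eval_word H f r"
begin

lemma eval_word_eq:
  "pres_eq Gs R v w \<Longrightarrow> v \<in> words Gs \<Longrightarrow> eval_word H f v = eval_word H f w"
proof (induction rule: pres_eq.induct)
  case (sym v w)
  then show ?case using pres_eq_words by metis
next
  case (trans u v w)
  then show ?case using pres_eq_words by metis
next
  case (cancel a u b v)
  have "eval_word H f ([(a, b), (a, \<not> b)] @ v) = eval_word H f v"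
    using cancel H.eval_word_closed[of Gs f v]
    by (cases b) (auto simp: f_closed H.m_assoc[symmetric])
  then show ?case using cancel
    by (simp add: H.eval_word_append[of Gs] f_closed del: append.simps)
next
  case (relator l r u v)
  then show ?case
    using f_relators[OF relator(1)] relators
    by (auto simp: H.eval_word_append[of Gs] f_closed)
qed auto

lemma pres_lift_cls:
  assumes "w \<in> words Gs"
  shows "pres_lift H f (cls w) = eval_word H f w"
proof -
  have "w \<in> cls w" using equiv_class_self[OF equiv_pres_rel assms] .
  then have "eval_word H f ` cls w = {eval_word H f w}"
    using eval_word_eq[OF pres_eq.sym] by (auto simp: pres_rel_def)
  then show ?thesis by (simp add: pres_lift_def)
qed

lemma pres_lift_gen [simp]: "a \<in> Gs \<Longrightarrow> pres_lift H f (gen a) = f a"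
  by (simp add: pres_gen_def pres_lift_cls f_closed)

lemma pres_lift_hom: "pres_lift H f \<in> hom P H"
  by (rule homI)
    (auto simp: carrier_P pres_lift_cls mult_P H.eval_word_append[of Gs] H.eval_word_closed[of Gs] f_closed)

lemma pres_lift_one: "pres_lift H f \<one>\<^bsub>P\<^esub> = \<one>\<^bsub>H\<^esub>"
  by (simp add: one_P pres_lift_cls)

end

section \<open>Free groups, braid groups and the Artin action\<close>

lemma presentation_free: "presentation {1..n} {}"
  by unfold_locales simp

lemma presentation_braid: "presentation {1..<n} (braid_relations n)"
  by unfold_locales (auto simp: braid_relations_def)

interpretation free: presentation "{1..n}" "{}"
  rewrites "presented_group {1..n} {} = free_group n" and "pres_gen {1..n} {} = free_gen n"
  for n :: nat
  by (rule presentation_free) (auto simp: free_group_def free_gen_def)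

interpretation braid: presentation "{1..<n}" "braid_relations n"
  rewrites "presented_group {1..<n} (braid_relations n) = braid_group n"
    and "pres_gen {1..<n} (braid_relations n) = braid_gen n"
  for n :: nat
  by (rule presentation_braid) (auto simp: braid_group_def braid_gen_def)

lemma presentation_hom_free:
  fixes n :: nat
  assumes "group H" and "\<And>a. a \<in> {1..n} \<Longrightarrow> f a \<in> carrier H"
  shows "presentation_hom {1..n} {} H f"
  using assms presentation_free[of n] by (simp add: presentation_hom_def presentation_hom_axioms_def)

text \<open>
  The far commutation relators come in both orders; one order is enough to check.
\<close>

lemma presentation_hom_braid:
  fixes n :: nat
  assumes "group H" and closed: "\<And>i. 1 \<le> i \<Longrightarrow> i < n \<Longrightarrow> f i \<in> carrier H"
    and adjacent: "\<And>i. 1 \<le> i \<Longrightarrow> Suc i < n \<Longrightarrow>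
      f i \<otimes>\<^bsub>H\<^esub> f (Suc i) \<otimes>\<^bsub>H\<^esub> f i = f (Suc i) \<otimes>\<^bsub>H\<^esub> f i \<otimes>\<^bsub>H\<^esub> f (Suc i)"
    and far: "\<And>i j. 1 \<le> i \<Longrightarrow> i + 2 \<le> j \<Longrightarrow> j < n \<Longrightarrow> f i \<otimes>\<^bsub>H\<^esub> f j = f j \<otimes>\<^bsub>H\<^esub> f i"
  shows "presentation_hom {1..<n} (braid_relations n) H f"
proof -
  interpret group H by fact
  show ?thesis
  proof (unfold_locales)
    fix l r assume "(l, r) \<in> braid_relations n"
    then consider (adjacent) i where "1 \<le> i" "Suc i < n"
        "l = [(i, True), (Suc i, True), (i, True)]" "r = [(Suc i, True), (i, True), (Suc i, True)]"
      | (far) i j where "1 \<le> i" "i < n" "1 \<le> j" "j < n" "i + 2 \<le> j \<or> j + 2 \<le> i"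
        "l = [(i, True), (j, True)]" "r = [(j, True), (i, True)]"
      unfolding braid_relations_def by blast
    then show "eval_word H f l = eval_word H f r"
    proof cases
      case (adjacent i)
      then show ?thesis
        using assms(3)[of i] closed[of i] closed[of "Suc i"] by (simp add: m_assoc)
    next
      case (far i j)
      then show ?thesis
        using assms(4)[of i j] assms(4)[of j i] closed[of i] closed[of j] by auto
    qed
  qed (use closed in auto)
qed

lemmas pres_lift_free = presentation_hom.pres_lift_hom[OF presentation_hom_free, folded free_group_def]
  and pres_lift_free_gen =
    presentation_hom.pres_lift_gen[OF presentation_hom_free, folded free_gen_def]

lemma (in group) list_mult_closed:
  "set xs \<subseteq> carrier G \<Longrightarrow> list_mult G xs \<in> carrier G"
  by (induction xs) (auto simp: list_mult_def)

lemma (in group) list_mult_append: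
  "set xs \<subseteq> carrier G \<Longrightarrow> set ys \<subseteq> carrier G \<Longrightarrow>
    list_mult G (xs @ ys) = list_mult G xs \<otimes> list_mult G ys"
proof (induction xs)
  case (Cons x xs)
  then show ?case
    using list_mult_closed[of xs] list_mult_closed[of ys] by (simp add: list_mult_def m_assoc)
qed (use list_mult_closed[of ys] in \<open>simp add: list_mult_def\<close>)

lemma list_mult_Cons [simp]: "list_mult G (x # xs) = x \<otimes>\<^bsub>G\<^esub> list_mult G xs"
  by (simp add: list_mult_def)

lemma (in group_hom) hom_list_mult:
  "set xs \<subseteq> carrier G \<Longrightarrow> h (list_mult G xs) = list_mult H (map h xs)"
proof (induction xs)
  case (Cons x xs)
  then show ?case using G.list_mult_closed[of xs] by simp
qed (simp add: list_mult_def)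

context group
begin

lemma inv_cancel_left [simp]:
  assumes "x \<in> carrier G" "y \<in> carrier G"
  shows "inv x \<otimes> (x \<otimes> y) = y" and "x \<otimes> (inv x \<otimes> y) = y"
  using assms by (simp_all add: m_assoc[symmetric])

lemma auto_group_mult:
  assumes "f \<in> carrier (AutoGroup G)" "h \<in> carrier (AutoGroup G)" "x \<in> carrier G"
  shows "(f \<otimes>\<^bsub>AutoGroup G\<^esub> h) x = f (h x)"
  using assms by (auto simp: AutoGroup_def BijGroup_def auto_def compose_def)

lemma auto_group_one: "x \<in> carrier G \<Longrightarrow> \<one>\<^bsub>AutoGroup G\<^esub> x = x"
  by (simp add: AutoGroup_def BijGroup_def)

lemma auto_group_hom: "f \<in> carrier (AutoGroup G) \<Longrightarrow> f \<in> hom G G"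
  by (simp add: AutoGroup_def auto_def)

lemma auto_group_eqI:
  assumes "f \<in> carrier (AutoGroup G)" "h \<in> carrier (AutoGroup G)"
    and "\<And>x. x \<in> carrier G \<Longrightarrow> f x = h x"
  shows "f = h"
  by (rule extensionalityI[of _ "carrier G"]) (use assms in \<open>auto simp: AutoGroup_def auto_def Bij_def\<close>)

end

locale artin_generator =
  fixes n i :: nat
  assumes i: "1 \<le> i" "i < n"
begin

abbreviation F where "F \<equiv> free_group n"
abbreviation x where "x \<equiv> free_gen n"
abbreviation \<theta> where "\<theta> \<equiv> artin_gen n i"

definition inverse_value where
  "inverse_value j = (if j = i then x i \<otimes>\<^bsub>F\<^esub> (x (Suc i) \<otimes>\<^bsub>F\<^esub> inv\<^bsub>F\<^esub> (x i))
    else if j = Suc i then x i else x j)"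

lemma x_carrier [simp]: "1 \<le> j \<Longrightarrow> j \<le> n \<Longrightarrow> x j \<in> carrier F"
  using free.gen_carrier[of j n] by simp

lemma x_i_carrier [simp]: "x i \<in> carrier F" "x (Suc i) \<in> carrier F"
  using i by (auto simp del: One_nat_def)

lemma artin_gen_hom: "\<theta> \<in> hom F F"
proof -
  have "pres_lift F (\<lambda>j. if j = i then x (Suc i)
            else if j = Suc i then inv\<^bsub>F\<^esub> (x (Suc i)) \<otimes>\<^bsub>F\<^esub> x i \<otimes>\<^bsub>F\<^esub> x (Suc i) else x j) \<in> hom F F"
    by (rule pres_lift_free) (auto intro: free.is_group)
  then show ?thesis by (auto simp: artin_gen_def hom_def)
qed

lemma artin_gen_x:
  assumes "1 \<le> j" "j \<le> n"
  shows "\<theta> (x j) = (if j = i then x (Suc i)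
    else if j = Suc i then inv\<^bsub>F\<^esub> (x (Suc i)) \<otimes>\<^bsub>F\<^esub> (x i \<otimes>\<^bsub>F\<^esub> x (Suc i)) else x j)"
proof -
  have "pres_lift F (\<lambda>j. if j = i then x (Suc i)
      else if j = Suc i then inv\<^bsub>F\<^esub> (x (Suc i)) \<otimes>\<^bsub>F\<^esub> x i \<otimes>\<^bsub>F\<^esub> x (Suc i) else x j) (x j) =
      (if j = i then x (Suc i)
      else if j = Suc i then inv\<^bsub>F\<^esub> (x (Suc i)) \<otimes>\<^bsub>F\<^esub> x i \<otimes>\<^bsub>F\<^esub> x (Suc i) else x j)"
    by (rule pres_lift_free_gen) (use assms in \<open>auto intro: free.is_group\<close>)
  then show ?thesis using assms by (auto simp: artin_gen_def free.m_assoc)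
qed

lemma inverse_hom: "pres_lift F inverse_value \<in> hom F F"
  by (rule pres_lift_free) (auto simp: inverse_value_def intro: free.is_group)

lemma inverse_x:
  assumes "1 \<le> j" "j \<le> n"
  shows "pres_lift F inverse_value (x j) = inverse_value j"
  by (rule pres_lift_free_gen) (use assms in \<open>auto simp: inverse_value_def intro: free.is_group\<close>)

sublocale \<theta>: group_hom F F \<theta>
  using artin_gen_hom by unfold_locales

sublocale \<theta>_inverse: group_hom F F "pres_lift F inverse_value"
  using inverse_hom by unfold_locales

text \<open>
  The endomorphism with the values \<open>inverse_value\<close> is a two-sided inverse of \<open>\<theta>\<close>, as both composites fix
  the generators.
\<close>

lemma artin_gen_auto: "\<theta> \<in> carrier (AutoGroup F)"
proof -
  let ?\<eta> = "pres_lift F inverse_value"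
  have id: "(\<lambda>y. y) \<in> hom F F" by (auto simp: hom_def)
  have 1: "(\<theta> \<circ> ?\<eta>) \<in> hom F F" "(?\<eta> \<circ> \<theta>) \<in> hom F F"
    using hom_compose artin_gen_hom inverse_hom by blast+
  have images: "\<theta> (x i) = x (Suc i)"
    "\<theta> (x (Suc i)) = inv\<^bsub>F\<^esub> (x (Suc i)) \<otimes>\<^bsub>F\<^esub> (x i \<otimes>\<^bsub>F\<^esub> x (Suc i))"
    "?\<eta> (x i) = x i \<otimes>\<^bsub>F\<^esub> (x (Suc i) \<otimes>\<^bsub>F\<^esub> inv\<^bsub>F\<^esub> (x i))" "?\<eta> (x (Suc i)) = x i"
    using i by (simp_all add: artin_gen_x inverse_x inverse_value_def)
  have gens: "\<theta> (?\<eta> (x j)) = x j \<and> ?\<eta> (\<theta> (x j)) = x j" if j: "j \<in> {1..n}" for j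
  proof (cases "j = i \<or> j = Suc i")
    case True
    then show ?thesis
      by (elim disjE) (simp_all add: images free.m_assoc free.inv_mult_group)
  next
    case False
    then have "\<theta> (x j) = x j" "?\<eta> (x j) = x j"
      using j by (simp_all add: artin_gen_x inverse_x inverse_value_def)
    then show ?thesis by simp
  qed
  have "(\<theta> \<circ> ?\<eta>) y = y" if "y \<in> carrier F" for y
    by (rule free.hom_eqI[OF 1(1) id free.is_group _ that]) (use gens in simp)
  moreover have "(?\<eta> \<circ> \<theta>) y = y" if "y \<in> carrier F" for y
    by (rule free.hom_eqI[OF 1(2) id free.is_group _ that]) (use gens in simp)
  ultimately have "bij_betw \<theta> (carrier F) (carrier F)"
    by (intro bij_betw_byWitness[of _ ?\<eta>]) auto
  then show ?thesis
    using artin_gen_hom by (simp add: AutoGroup_def auto_def Bij_def) (simp add: artin_gen_def)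
qed

text \<open>
  Only the two letters \<open>x\<^sub>i x\<^sub>i\<^sub>+\<^sub>1\<close> of the product move, and they become
  \<open>x\<^sub>i\<^sub>+\<^sub>1 (x\<^sub>i\<^sub>+\<^sub>1\<^sup>-\<^sup>1 x\<^sub>i x\<^sub>i\<^sub>+\<^sub>1) = x\<^sub>i x\<^sub>i\<^sub>+\<^sub>1\<close>.
\<close>

lemma artin_gen_product:
  "\<theta> (list_mult F (map x [1..<Suc n])) = list_mult F (map x [1..<Suc n])"
proof -
  have split: "[1..<Suc n] = [1..<i] @ i # Suc i # [Suc (Suc i)..<Suc n]"
    using i upt_add_eq_append[of 1 i "Suc n - i"] by (simp add: upt_conv_Cons del: upt_Suc)
  define us where "us = map x [1..<i]"
  define vs where "vs = map x [Suc (Suc i)..<Suc n]"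
  have fixed: "map \<theta> us = us" "map \<theta> vs = vs"
    using i by (auto simp: us_def vs_def artin_gen_x simp del: upt_Suc)
  have closed: "set us \<subseteq> carrier F" "set vs \<subseteq> carrier F"
    using i by (auto simp: us_def vs_def simp del: upt_Suc)
  have pair: "\<theta> (x i) = x (Suc i)"
    "\<theta> (x (Suc i)) = inv\<^bsub>F\<^esub> (x (Suc i)) \<otimes>\<^bsub>F\<^esub> (x i \<otimes>\<^bsub>F\<^esub> x (Suc i))"
    using i by (simp_all add: artin_gen_x)
  have "map x [1..<Suc n] = us @ x i # x (Suc i) # vs"
    by (simp only: split map_append list.map us_def vs_def)
  moreover have "\<theta> (list_mult F (us @ x i # x (Suc i) # vs)) = list_mult F (us @ x i # x (Suc i) # vs)"
    using closed
    by (simp add: \<theta>.hom_list_mult fixed pair free.list_mult_append free.list_mult_closed free.m_assoc)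
  ultimately show ?thesis by simp
qed

end

lemmas artin_gen_auto = artin_generator.artin_gen_auto[OF artin_generator.intro]
  and artin_gen_x = artin_generator.artin_gen_x[OF artin_generator.intro]

lemma artin_auto_eqI:
  assumes "f \<in> carrier (AutoGroup (free_group n))" "h \<in> carrier (AutoGroup (free_group n))"
    and "\<And>j. 1 \<le> j \<Longrightarrow> j \<le> n \<Longrightarrow> f (free_gen n j) = h (free_gen n j)"
  shows "f = h"
proof (rule free.auto_group_eqI[OF assms(1,2)])
  fix x assume "x \<in> carrier (free_group n)"
  then show "f x = h x"
    using assms(3)
    by - (rule free.hom_eqI[OF free.auto_group_hom[OF assms(1)] free.auto_group_hom[OF assms(2)] free.is_group];
      simp)
qed

lemma artin_gen_far:
  assumes ij: "1 \<le> i" "i + 2 \<le> j" "j < n"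
  shows "artin_gen n i \<otimes>\<^bsub>AutoGroup (free_group n)\<^esub> artin_gen n j =
    artin_gen n j \<otimes>\<^bsub>AutoGroup (free_group n)\<^esub> artin_gen n i"
proof -
  interpret A: group "AutoGroup (free_group n)" by (rule free.AutoGroup)
  have c: "artin_gen n i \<in> carrier (AutoGroup (free_group n))"
    "artin_gen n j \<in> carrier (AutoGroup (free_group n))"
    using ij by (auto intro: artin_gen_auto)
  interpret i: group_hom "free_group n" "free_group n" "artin_gen n i"
    using free.auto_group_hom[OF c(1)] by unfold_locales
  interpret j: group_hom "free_group n" "free_group n" "artin_gen n j"
    using free.auto_group_hom[OF c(2)] by unfold_locales
  have x: "1 \<le> k \<Longrightarrow> k \<le> n \<Longrightarrow> free_gen n k \<in> carrier (free_group n)" for k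
    using free.gen_carrier[of k n] by simp
  show ?thesis
  proof (rule artin_auto_eqI)
    fix k assume k: "1 \<le> k" "k \<le> n"
    have "artin_gen n i (artin_gen n j (free_gen n k)) = artin_gen n j (artin_gen n i (free_gen n k))"
      using ij k x[of i] x[of "Suc i"] x[of j] x[of "Suc j"] by (simp add: artin_gen_x)
    then show "(artin_gen n i \<otimes>\<^bsub>AutoGroup (free_group n)\<^esub> artin_gen n j) (free_gen n k) =
      (artin_gen n j \<otimes>\<^bsub>AutoGroup (free_group n)\<^esub> artin_gen n i) (free_gen n k)"
      using x[OF k] c by (simp add: free.auto_group_mult)
  qed (use c in auto)
qed

text \<open>
  With \<open>p, q, r\<close> for the generators \<open>x\<^sub>i, x\<^sub>i\<^sub>+\<^sub>1, x\<^sub>i\<^sub>+\<^sub>2\<close>, both sides are the automorphism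
  \<open>p \<mapsto> r\<close>, \<open>q \<mapsto> r\<^sup>-\<^sup>1 q r\<close>, \<open>r \<mapsto> r\<^sup>-\<^sup>1 q\<^sup>-\<^sup>1 p q r\<close>.
\<close>

lemma artin_gen_adjacent:
  assumes i: "1 \<le> i" "Suc i < n"
  shows "artin_gen n i \<otimes>\<^bsub>AutoGroup (free_group n)\<^esub> artin_gen n (Suc i) \<otimes>\<^bsub>AutoGroup (free_group n)\<^esub> artin_gen n i =
    artin_gen n (Suc i) \<otimes>\<^bsub>AutoGroup (free_group n)\<^esub> artin_gen n i \<otimes>\<^bsub>AutoGroup (free_group n)\<^esub> artin_gen n (Suc i)"
proof -
  let ?F = "free_group n" and ?x = "free_gen n"
  interpret A: group "AutoGroup ?F" by (rule free.AutoGroup)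
  define f where "f = artin_gen n i"
  define h where "h = artin_gen n (Suc i)"
  have c: "f \<in> carrier (AutoGroup ?F)" "h \<in> carrier (AutoGroup ?F)"
    using i artin_gen_auto by (simp_all add: f_def h_def)
  interpret f: group_hom ?F ?F f using free.auto_group_hom[OF c(1)] by unfold_locales
  interpret h: group_hom ?F ?F h using free.auto_group_hom[OF c(2)] by unfold_locales
  have "f \<otimes>\<^bsub>AutoGroup ?F\<^esub> h \<otimes>\<^bsub>AutoGroup ?F\<^esub> f = h \<otimes>\<^bsub>AutoGroup ?F\<^esub> f \<otimes>\<^bsub>AutoGroup ?F\<^esub> h"
  proof (rule artin_auto_eqI)
    fix k assume k: "1 \<le> k" "k \<le> n"
    define p q r where "p = ?x i" "q = ?x (Suc i)" "r = ?x (Suc (Suc i))"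
    have m: "p \<in> carrier ?F" "q \<in> carrier ?F" "r \<in> carrier ?F" "?x k \<in> carrier ?F"
      using i k free.gen_carrier[of _ n] by (auto simp: p_q_r_def)
    have f: "f p = q" "f q = inv\<^bsub>?F\<^esub> q \<otimes>\<^bsub>?F\<^esub> (p \<otimes>\<^bsub>?F\<^esub> q)" "f r = r"
      using i by (simp_all add: p_q_r_def f_def artin_gen_x)
    have h: "h p = p" "h q = r" "h r = inv\<^bsub>?F\<^esub> r \<otimes>\<^bsub>?F\<^esub> (q \<otimes>\<^bsub>?F\<^esub> r)"
      using i by (simp_all add: p_q_r_def h_def artin_gen_x)
    have *: "f (h (f (?x k))) = h (f (h (?x k)))"
    proof -
      consider "k = i" | "k = Suc i" | "k = Suc (Suc i)" | "k \<noteq> i" "k \<noteq> Suc i" "k \<noteq> Suc (Suc i)"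
        by blast
      then show ?thesis
      proof cases
        case 1
        then show ?thesis by (simp add: f h flip: p_q_r_def)
      next
        case 2
        then show ?thesis by (simp add: f h m free.m_assoc flip: p_q_r_def)
      next
        case 3
        then show ?thesis by (simp add: f h m free.m_assoc free.inv_mult_group flip: p_q_r_def)
      next
        case 4
        then have "f (?x k) = ?x k" "h (?x k) = ?x k"
          using k i by (simp_all add: f_def h_def artin_gen_x)
        then show ?thesis by simp
      qed
    qed
    then show "(f \<otimes>\<^bsub>AutoGroup ?F\<^esub> h \<otimes>\<^bsub>AutoGroup ?F\<^esub> f) (?x k) = (h \<otimes>\<^bsub>AutoGroup ?F\<^esub> f \<otimes>\<^bsub>AutoGroup ?F\<^esub> h) (?x k)"
      using m c by (simp add: free.auto_group_mult)
  qed (use c in auto)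
  then show ?thesis by (simp add: f_def h_def)
qed

lemma presentation_hom_artin:
  "presentation_hom {1..<n} (braid_relations n) (AutoGroup (free_group n)) (artin_gen n)"
proof (rule presentation_hom_braid)
  show "group (AutoGroup (free_group n))" by (rule free.AutoGroup)
qed (erule artin_gen_auto artin_gen_adjacent artin_gen_far, assumption+)+

lemma artin_action_hom: "artin_action n \<in> hom (braid_group n) (AutoGroup (free_group n))"
  using presentation_hom.pres_lift_hom[OF presentation_hom_artin[of n]]
  by (simp add: artin_action_def braid_group_def)

lemma artin_action_gen: "1 \<le> i \<Longrightarrow> i < n \<Longrightarrow> artin_action n (braid_gen n i) = artin_gen n i"
  using presentation_hom.pres_lift_gen[OF presentation_hom_artin[of n], of i]
  by (simp add: artin_action_def braid_gen_def)

section \<open>Representations of the semidirect product\<close>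

text \<open>
  A homomorphism on a semidirect product is a pair of homomorphisms on the factors that is
  compatible with the action; the last claim is the compatibility \<open>b x = \<phi>\<^sub>b(x) b\<close>.
\<close>

lemma semidirect_hom:
  assumes K: "group K" and H: "group H" and M: "group M" and \<phi>: "\<phi> \<in> hom H (AutoGroup K)"
    and r: "r \<in> hom (semidirect K H \<phi>) M"
  shows semidirect_hom_fst: "(\<lambda>x. r (x, \<one>\<^bsub>H\<^esub>)) \<in> hom K M"
    and semidirect_hom_snd: "(\<lambda>b. r (\<one>\<^bsub>K\<^esub>, b)) \<in> hom H M"
    and semidirect_hom_conj: "x \<in> carrier K \<Longrightarrow> b \<in> carrier H \<Longrightarrow>
      r (\<one>\<^bsub>K\<^esub>, b) \<otimes>\<^bsub>M\<^esub> r (x, \<one>\<^bsub>H\<^esub>) = r (\<phi> b x, \<one>\<^bsub>H\<^esub>) \<otimes>\<^bsub>M\<^esub> r (\<one>\<^bsub>K\<^esub>, b)"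
proof -
  interpret K: group K by fact
  interpret H: group H by fact
  interpret A: group "AutoGroup K" by (rule K.AutoGroup)
  interpret \<phi>: group_hom H "AutoGroup K" \<phi> using \<phi> by unfold_locales
  have auto_b: "\<phi> b \<in> hom K K" if "b \<in> carrier H" for b
    using K.auto_group_hom \<phi>.hom_closed[OF that] .
  have \<phi>_closed: "\<phi> b x \<in> carrier K" if "b \<in> carrier H" "x \<in> carrier K" for b x
    using auto_b[OF that(1)] that(2) by (auto simp: hom_def)
  have \<phi>_one: "\<phi> b \<one>\<^bsub>K\<^esub> = \<one>\<^bsub>K\<^esub>" if "b \<in> carrier H" for b
    using hom_one[OF auto_b[OF that] K K] .
  have one_\<phi>: "\<phi> \<one>\<^bsub>H\<^esub> x = x" if "x \<in> carrier K" for x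
    using K.auto_group_one[OF that] by simp
  have r_mult: "r (x \<otimes>\<^bsub>K\<^esub> \<phi> b y, b \<otimes>\<^bsub>H\<^esub> c) = r (x, b) \<otimes>\<^bsub>M\<^esub> r (y, c)"
    if "x \<in> carrier K" "y \<in> carrier K" "b \<in> carrier H" "c \<in> carrier H" for x y b c
    using hom_mult[OF r, of "(x, b)" "(y, c)"] that by (simp add: semidirect_def)
  have r_closed: "r (x, b) \<in> carrier M" if "x \<in> carrier K" "b \<in> carrier H" for x b
    using hom_carrier[OF r] that by (auto simp: semidirect_def)
  show "(\<lambda>x. r (x, \<one>\<^bsub>H\<^esub>)) \<in> hom K M"
    using r_mult[where b = "\<one>\<^bsub>H\<^esub>" and c = "\<one>\<^bsub>H\<^esub>"] by (auto simp: hom_def r_closed K.auto_group_one)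
  show "(\<lambda>b. r (\<one>\<^bsub>K\<^esub>, b)) \<in> hom H M"
    using r_mult[of "\<one>\<^bsub>K\<^esub>" "\<one>\<^bsub>K\<^esub>"] by (auto simp: hom_def r_closed \<phi>_one)
  show "r (\<one>\<^bsub>K\<^esub>, b) \<otimes>\<^bsub>M\<^esub> r (x, \<one>\<^bsub>H\<^esub>) = r (\<phi> b x, \<one>\<^bsub>H\<^esub>) \<otimes>\<^bsub>M\<^esub> r (\<one>\<^bsub>K\<^esub>, b)"
    if "x \<in> carrier K" "b \<in> carrier H"
    using r_mult[of "\<one>\<^bsub>K\<^esub>" x b "\<one>\<^bsub>H\<^esub>"] r_mult[of "\<phi> b x" "\<one>\<^bsub>K\<^esub>" "\<one>\<^bsub>H\<^esub>" b] that
    by (simp add: \<phi>_closed K.auto_group_one)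
qed

text \<open>
  All that the linear algebra below needs to know about a representation of the semidirect product.
  The relation for \<open>x\<^sub>i\<^sub>+\<^sub>1\<close> is multiplied by \<open>x\<^sub>i\<^sub>+\<^sub>1\<close> so that no inverses occur.
\<close>

lemma free_braid_hom_relations:
  assumes M: "group M" and r: "r \<in> hom (free_braid n) M"
  defines "A \<equiv> \<lambda>j. r (fb_x n j)" and "T \<equiv> \<lambda>i. r (fb_sigma n i)"
  shows free_braid_x_closed: "1 \<le> j \<Longrightarrow> j \<le> n \<Longrightarrow> A j \<in> carrier M"
    and sigma_closed: "1 \<le> i \<Longrightarrow> i < n \<Longrightarrow> T i \<in> carrier M"
    and sigma_x: "1 \<le> i \<Longrightarrow> i < n \<Longrightarrow> T i \<otimes>\<^bsub>M\<^esub> A i = A (Suc i) \<otimes>\<^bsub>M\<^esub> T i"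
    and sigma_x_Suc: "1 \<le> i \<Longrightarrow> i < n \<Longrightarrow>
      A (Suc i) \<otimes>\<^bsub>M\<^esub> (T i \<otimes>\<^bsub>M\<^esub> A (Suc i)) = A i \<otimes>\<^bsub>M\<^esub> (A (Suc i) \<otimes>\<^bsub>M\<^esub> T i)"
    and sigma_x_other: "1 \<le> i \<Longrightarrow> i < n \<Longrightarrow> 1 \<le> j \<Longrightarrow> j \<le> n \<Longrightarrow> j \<noteq> i \<Longrightarrow> j \<noteq> Suc i \<Longrightarrow>
      T i \<otimes>\<^bsub>M\<^esub> A j = A j \<otimes>\<^bsub>M\<^esub> T i"
    and sigma_adjacent: "1 \<le> i \<Longrightarrow> Suc i < n \<Longrightarrow>
      T i \<otimes>\<^bsub>M\<^esub> T (Suc i) \<otimes>\<^bsub>M\<^esub> T i = T (Suc i) \<otimes>\<^bsub>M\<^esub> T i \<otimes>\<^bsub>M\<^esub> T (Suc i)"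
    and sigma_far: "1 \<le> i \<Longrightarrow> i + 2 \<le> j \<Longrightarrow> j < n \<Longrightarrow> T i \<otimes>\<^bsub>M\<^esub> T j = T j \<otimes>\<^bsub>M\<^esub> T i"
    and sigma_product: "1 \<le> i \<Longrightarrow> i < n \<Longrightarrow>
      T i \<otimes>\<^bsub>M\<^esub> list_mult M (map A [1..<Suc n]) = list_mult M (map A [1..<Suc n]) \<otimes>\<^bsub>M\<^esub> T i"
proof -
  let ?F = "free_group n" and ?B = "braid_group n"
  interpret M: group M by fact
  note r' = r[unfolded free_braid_def]
  note sd = free.is_group[of n] braid.is_group[of n] M artin_action_hom[of n] r'
  define u where "u = (\<lambda>x. r (x, \<one>\<^bsub>?B\<^esub>))"
  define t where "t = (\<lambda>b. r (\<one>\<^bsub>?F\<^esub>, b))"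
  interpret u: group_hom ?F M u
    using semidirect_hom_fst[OF sd] by unfold_locales (simp add: u_def)
  interpret t: group_hom ?B M t
    using semidirect_hom_snd[OF sd] by unfold_locales (simp add: t_def)
  have conj: "t b \<otimes>\<^bsub>M\<^esub> u x = u (artin_action n b x) \<otimes>\<^bsub>M\<^esub> t b"
    if "x \<in> carrier ?F" "b \<in> carrier ?B" for x b
    using semidirect_hom_conj[OF sd that] by (simp add: u_def t_def)
  have A: "A j = u (free_gen n j)" and T: "T i = t (braid_gen n i)" for i j
    by (simp_all add: A_def T_def u_def t_def fb_x_def fb_sigma_def)
  have x [simp]: "1 \<le> j \<Longrightarrow> j \<le> n \<Longrightarrow> free_gen n j \<in> carrier ?F" for j
    using free.gen_carrier[of j n] by simp
  have sigma [simp]: "1 \<le> i \<Longrightarrow> i < n \<Longrightarrow> braid_gen n i \<in> carrier ?B" for i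
    using braid.gen_carrier[of i n] by simp
  have conj_gen: "T i \<otimes>\<^bsub>M\<^esub> u x = u (artin_gen n i x) \<otimes>\<^bsub>M\<^esub> T i"
    if "1 \<le> i" "i < n" "x \<in> carrier ?F" for i x
    using conj[of x "braid_gen n i"] that by (simp add: T artin_action_gen)
  show X_closed: "1 \<le> j \<Longrightarrow> j \<le> n \<Longrightarrow> A j \<in> carrier M" for j by (simp add: A)
  show T_closed: "1 \<le> i \<Longrightarrow> i < n \<Longrightarrow> T i \<in> carrier M" for i by (simp add: T)
  show "1 \<le> i \<Longrightarrow> i < n \<Longrightarrow> T i \<otimes>\<^bsub>M\<^esub> A i = A (Suc i) \<otimes>\<^bsub>M\<^esub> T i"
    using conj_gen[of i "free_gen n i"] artin_gen_x[of i n i] by (simp add: A)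
  show "1 \<le> i \<Longrightarrow> i < n \<Longrightarrow>
      A (Suc i) \<otimes>\<^bsub>M\<^esub> (T i \<otimes>\<^bsub>M\<^esub> A (Suc i)) = A i \<otimes>\<^bsub>M\<^esub> (A (Suc i) \<otimes>\<^bsub>M\<^esub> T i)"
    using conj_gen[of i "free_gen n (Suc i)"] artin_gen_x[of i n "Suc i"] x[of i] x[of "Suc i"]
    by (simp add: A M.m_assoc T)
  show "1 \<le> i \<Longrightarrow> i < n \<Longrightarrow> 1 \<le> j \<Longrightarrow> j \<le> n \<Longrightarrow> j \<noteq> i \<Longrightarrow> j \<noteq> Suc i \<Longrightarrow>
      T i \<otimes>\<^bsub>M\<^esub> A j = A j \<otimes>\<^bsub>M\<^esub> T i"
    using conj_gen[of i "free_gen n j"] artin_gen_x[of i n j] by (simp add: A)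
  have rel: "eval_word M T l = eval_word M T w" if "(l, w) \<in> braid_relations n" for l w
  proof -
    have lw: "l \<in> words {1..<n}" "w \<in> words {1..<n}" using that braid.relators by auto
    have T': "T = (\<lambda>i. t (braid_gen n i))" by (rule ext) (rule T)
    show ?thesis
      using hom_eval_word[where f = "braid_gen n", OF t.homh braid.is_group M braid.gen_carrier lw(1)]
        hom_eval_word[where f = "braid_gen n", OF t.homh braid.is_group M braid.gen_carrier lw(2)]
        braid.eval_word_relator[OF that] by (simp add: T')
  qed
  show "T i \<otimes>\<^bsub>M\<^esub> T (Suc i) \<otimes>\<^bsub>M\<^esub> T i = T (Suc i) \<otimes>\<^bsub>M\<^esub> T i \<otimes>\<^bsub>M\<^esub> T (Suc i)"
    if "1 \<le> i" "Suc i < n" for i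
    using rel[of "[(i, True), (Suc i, True), (i, True)]" "[(Suc i, True), (i, True), (Suc i, True)]"] that
      T_closed[of i] T_closed[of "Suc i"]
    by (simp add: M.m_assoc braid_relations_def)
  show "T i \<otimes>\<^bsub>M\<^esub> T j = T j \<otimes>\<^bsub>M\<^esub> T i" if "1 \<le> i" "i + 2 \<le> j" "j < n" for i j
    using rel[of "[(i, True), (j, True)]" "[(j, True), (i, True)]"] that T_closed[of i] T_closed[of j]
    by (simp add: M.m_assoc braid_relations_def)
  show "T i \<otimes>\<^bsub>M\<^esub> list_mult M (map A [1..<Suc n]) = list_mult M (map A [1..<Suc n]) \<otimes>\<^bsub>M\<^esub> T i"
    if "1 \<le> i" "i < n" for i
  proof -
    have xs: "set (map (free_gen n) [1..<Suc n]) \<subseteq> carrier ?F" by (auto simp del: upt_Suc)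
    have "list_mult M (map A [1..<Suc n]) = u (list_mult ?F (map (free_gen n) [1..<Suc n]))"
      using u.hom_list_mult[OF xs] by (simp only: A list.map_comp comp_def cong: map_cong)
    then show ?thesis
      using conj_gen[OF that free.list_mult_closed[OF xs]]
        artin_generator.artin_gen_product[OF artin_generator.intro[OF that]] by simp
  qed
qed

section \<open>Invertible matrices\<close>

lemma group_GL: "group (GL TYPE('k :: field) N)"
proof -
  interpret ring "ring_mat TYPE('k) N ()" by (rule ring_mat)
  show ?thesis unfolding GL_def by (rule units_group)
qed

lemma GL_mult [simp]: "A \<otimes>\<^bsub>GL ty N\<^esub> B = A * B"
  by (simp add: GL_def units_of_mult ring_mat_simps)

lemma GL_one [simp]: "\<one>\<^bsub>GL ty N\<^esub> = 1\<^sub>m N"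
  by (simp add: GL_def units_of_one ring_mat_simps)

lemma GL_carrier_mat: "A \<in> carrier (GL ty N) \<Longrightarrow> A \<in> carrier_mat N N"
  by (auto simp: GL_def units_of_carrier Units_def ring_mat_simps)

lemma GL_injective:
  assumes A: "A \<in> carrier (GL ty N)" and v: "v \<in> carrier_vec N" "w \<in> carrier_vec N" and "A *\<^sub>v v = A *\<^sub>v w"
  shows "v = w"
proof -
  obtain B where B: "B \<in> carrier_mat N N" "B * A = 1\<^sub>m N"
    using A by (auto simp: GL_def units_of_carrier Units_def ring_mat_simps)
  have "u = B *\<^sub>v (A *\<^sub>v u)" if "u \<in> carrier_vec N" for u
    using assoc_mult_mat_vec[OF B(1) GL_carrier_mat[OF A] that] B(2) that by simp
  with v assms(4) show ?thesis by metis
qed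

text \<open>
  For a large block matrix, triviality of the kernel can be read off from its block rows one after
  the other; no inverse or determinant has to be written down.
\<close>

lemma GL_injectiveI:
  fixes A :: "'k :: field mat"
  assumes A: "A \<in> carrier_mat N N"
    and inj: "\<And>v. v \<in> carrier_vec N \<Longrightarrow> A *\<^sub>v v = 0\<^sub>v N \<Longrightarrow> v = 0\<^sub>v N"
  shows "A \<in> carrier (GL TYPE('k) N)"
proof -
  have "det A \<noteq> 0" using det_0_iff_vec_prod_zero_field[OF A] inj by blast
  from det_non_zero_imp_unit[OF A this] show ?thesis by (simp add: GL_def units_of_carrier)
qed

lemma mult_unit_vec_col:
  fixes A :: "'k :: comm_ring_1 mat"
  assumes "A \<in> carrier_mat m d" "j < d"
  shows "A *\<^sub>v unit_vec d j = col A j"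
  by (rule eq_vecI) (use assms in \<open>auto simp: scalar_prod_right_unit\<close>)

lemma mat_eqI_mult_vec:
  fixes A :: "'k :: comm_ring_1 mat"
  assumes A: "A \<in> carrier_mat m d" and B: "B \<in> carrier_mat m d"
    and eq: "\<And>v. v \<in> carrier_vec d \<Longrightarrow> A *\<^sub>v v = B *\<^sub>v v"
  shows "A = B"
proof (rule mat_col_eqI)
  fix j assume "j < dim_col B"
  then have j: "j < d" using B by simp
  show "col A j = col B j"
    using eq[of "unit_vec d j"] mult_unit_vec_col[OF A j] mult_unit_vec_col[OF B j] by simp
qed (use A B in auto)

section \<open>Block vectors and block matrices\<close>

lemma block_vec_carrier [simp]: "block_vec N p v \<in> carrier_vec N" "dim_vec (block_vec N p v) = N"
  by (simp_all add: block_vec_def)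

lemma block_vec_index: "a < N \<Longrightarrow> block_vec N p v $ a = v $ ((p - 1) * N + a)"
  by (simp add: block_vec_def)

lemma block_index_less:
  fixes p n N a :: nat
  assumes "1 \<le> p" "p \<le> n" "a < N"
  shows "(p - 1) * N + a < n * N"
proof -
  obtain q where "p = Suc q" using assms(1) by (metis Suc_le_D One_nat_def)
  then have "(p - 1) * N + N = p * N" by simp
  also have "\<dots> \<le> n * N" using assms(2) by simp
  finally show ?thesis using assms(3) by simp
qed

text \<open>
  This lets an identity between matrices of size \<open>n N\<close> be checked by applying both sides to a vector
  and comparing blocks, where only matrices of size \<open>N\<close> occur.
\<close>

lemma block_vec_eqI:
  assumes v: "v \<in> carrier_vec (n * N)" and w: "w \<in> carrier_vec (n * N)"
    and eq: "\<And>p. 1 \<le> p \<Longrightarrow> p \<le> n \<Longrightarrow> block_vec N p v = block_vec N p w"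
  shows "v = w"
proof (rule eq_vecI)
  fix a assume "a < dim_vec w"
  then have a: "a < n * N" using w by simp
  then have N: "N > 0" by (cases N) auto
  have "a div N < n" using a by (simp add: less_mult_imp_div_less)
  then have "block_vec N (Suc (a div N)) v $ (a mod N) = block_vec N (Suc (a div N)) w $ (a mod N)"
    using eq[of "Suc (a div N)"] by simp
  then show "v $ a = w $ a" using N by (simp add: block_vec_index)
qed (use v w in auto)

definition concat_blocks :: "nat \<Rightarrow> nat \<Rightarrow> (nat \<Rightarrow> 'k vec) \<Rightarrow> 'k vec" where
  "concat_blocks n N f = vec (n * N) (\<lambda>a. f (Suc (a div N)) $ (a mod N))"

lemma concat_blocks_carrier [simp]: "concat_blocks n N f \<in> carrier_vec (n * N)"
  by (simp add: concat_blocks_def)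

lemma block_vec_concat_blocks:
  assumes "1 \<le> p" "p \<le> n" and "f p \<in> carrier_vec N"
  shows "block_vec N p (concat_blocks n N f) = f p"
proof (rule eq_vecI)
  fix a assume "a < dim_vec (f p)"
  then have a: "a < N" using assms(3) by simp
  show "block_vec N p (concat_blocks n N f) $ a = f p $ a"
    using block_index_less[OF assms(1,2) a] a assms(1)
    by (simp add: block_vec_index concat_blocks_def)
qed (use assms(3) in auto)

lemma block_vec_zero:
  assumes "1 \<le> p" "p \<le> n"
  shows "block_vec N p (0\<^sub>v (n * N)) = 0\<^sub>v N"
  by (rule eq_vecI) (use block_index_less[OF assms] in \<open>auto simp: block_vec_index\<close>)

lemma block_vec_append_left:
  assumes a: "a \<in> carrier_vec (m * N)" and "1 \<le> p" "p \<le> m"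
  shows "block_vec N p (a @\<^sub>v d) = block_vec N p a"
  by (rule eq_vecI) (use a block_index_less[OF assms(2,3)] in \<open>auto simp: block_vec_index trans_less_add1\<close>)

lemma block_vec_append_right:
  assumes a: "a \<in> carrier_vec (m * N)" and d: "d \<in> carrier_vec (n * N)" and "1 \<le> p" "p \<le> n"
  shows "block_vec N (m + p) (a @\<^sub>v d) = block_vec N p d"
proof (rule eq_vecI)
  fix t assume "t < dim_vec (block_vec N p d)"
  then have t: "t < N" by simp
  obtain q where q: "p = Suc q" using assms(3) by (metis Suc_le_D One_nat_def)
  show "block_vec N (m + p) (a @\<^sub>v d) $ t = block_vec N p d $ t"
    using block_index_less[OF assms(3,4) t] a d t by (simp add: q block_vec_index add_mult_distrib)
qed simp

lemma block_vec_single: "v \<in> carrier_vec N \<Longrightarrow> block_vec N (Suc 0) v = v"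
  by (rule eq_vecI) (auto simp: block_vec_index)

lemma block_mat_carrier [simp]: "block_mat n N B \<in> carrier_mat (n * N) (n * N)"
  by (simp add: block_mat_def)

text \<open>
  The sum over all columns is grouped into \<open>n\<close> runs of length \<open>N\<close>, one for each block column.
\<close>

lemma block_mat_mult_vec:
  fixes B :: "nat \<Rightarrow> nat \<Rightarrow> 'k :: comm_ring_1 mat"
  assumes p: "1 \<le> p" "p \<le> n" and B: "\<And>q. 1 \<le> q \<Longrightarrow> q \<le> n \<Longrightarrow> B p q \<in> carrier_mat N N"
    and v: "v \<in> carrier_vec (n * N)" and a: "a < N"
  shows "block_vec N p (block_mat n N B *\<^sub>v v) $ a = (\<Sum>q=1..n. (B p q *\<^sub>v block_vec N q v) $ a)"
proof -
  let ?r = "(p - 1) * N + a"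
  have r: "?r < n * N" using block_index_less[OF p a] .
  have row: "?r div N = p - 1" "?r mod N = a" using a by auto
  have "block_vec N p (block_mat n N B *\<^sub>v v) $ a = (block_mat n N B *\<^sub>v v) $ ?r"
    using a by (simp add: block_vec_index)
  also have "\<dots> = (\<Sum>b<n * N. block_mat n N B $$ (?r, b) * v $ b)"
    using r v by (simp add: scalar_prod_def block_mat_def lessThan_atLeast0)
  also have "\<dots> = (\<Sum>m<n. \<Sum>b=m * N..<m * N + N. block_mat n N B $$ (?r, b) * v $ b)"
    by (rule sum.nat_group[symmetric])
  also have "\<dots> = (\<Sum>m<n. (B p (Suc m) *\<^sub>v block_vec N (Suc m) v) $ a)"
  proof (rule sum.cong)
    fix m assume "m \<in> {..<n}"
    then have m: "m < n" by simp
    have "(\<Sum>b=m * N..<m * N + N. block_mat n N B $$ (?r, b) * v $ b) =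
      (\<Sum>b<N. block_mat n N B $$ (?r, m * N + b) * v $ (m * N + b))"
      using sum.shift_bounds_nat_ivl[of "\<lambda>b. block_mat n N B $$ (?r, b) * v $ b" 0 "m * N" N]
      by (simp add: add.commute lessThan_atLeast0)
    also have "\<dots> = (\<Sum>b<N. B p (Suc m) $$ (a, b) * block_vec N (Suc m) v $ b)"
    proof (rule sum.cong)
      fix b assume "b \<in> {..<N}"
      then have b: "b < N" by simp
      have "m * N + b < n * N" using block_index_less[of "Suc m" n b N] m b by simp
      moreover have "Suc (p - 1) = p" using p by simp
      moreover have "(m * N + b) div N = m" "(m * N + b) mod N = b" using b by auto
      ultimately have "block_mat n N B $$ (?r, m * N + b) = B p (Suc m) $$ (a, b)"
        using r row unfolding block_mat_def by simp
      then show "block_mat n N B $$ (?r, m * N + b) * v $ (m * N + b) =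
          B p (Suc m) $$ (a, b) * block_vec N (Suc m) v $ b"
        using b by (simp add: block_vec_index)
    qed simp
    also have "\<dots> = (B p (Suc m) *\<^sub>v block_vec N (Suc m) v) $ a"
      using B[of "Suc m"] m a by (auto simp: scalar_prod_def lessThan_atLeast0)
    finally show "(\<Sum>b=m * N..<m * N + N. block_mat n N B $$ (?r, b) * v $ b) =
      (B p (Suc m) *\<^sub>v block_vec N (Suc m) v) $ a" .
  qed simp
  also have "\<dots> = (\<Sum>q=1..n. (B p q *\<^sub>v block_vec N q v) $ a)"
    by (simp add: sum.atLeast_Suc_atMost_Suc_shift atLeast0LessThan[symmetric] sum.atLeast1_atMost_eq)
  finally show ?thesis .
qed

lemma diag_block_mat_Cons_mult_vec:
  assumes "A \<in> carrier_mat a a" "diag_block_mat As \<in> carrier_mat d d" "v \<in> carrier_vec a" "w \<in> carrier_vec d"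
  shows "diag_block_mat (A # As) *\<^sub>v (v @\<^sub>v w) = (A *\<^sub>v v) @\<^sub>v (diag_block_mat As *\<^sub>v w)"
proof -
  have "diag_block_mat (A # As) = four_block_mat A (0\<^sub>m a d) (0\<^sub>m d a) (diag_block_mat As)"
    using assms(1,2) by (auto simp: Let_def)
  then show ?thesis using mult_mat_vec_split[OF assms] by simp
qed

lemma diag_block_mat_replicate_carrier:
  "A \<in> carrier_mat N N \<Longrightarrow> diag_block_mat (replicate n A) \<in> carrier_mat (n * N) (n * N)"
  using dim_diag_block_mat[of "replicate n A"] by (auto simp: sum_list_replicate)

lemma block_vec_diag_replicate:
  assumes A: "A \<in> carrier_mat N N" and "v \<in> carrier_vec (n * N)" "1 \<le> p" "p \<le> n"
  shows "block_vec N p (diag_block_mat (replicate n A) *\<^sub>v v) = A *\<^sub>v block_vec N p v"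
  using assms(2-4)
proof (induction n arbitrary: v p)
  case (Suc n)
  let ?D = "diag_block_mat (replicate n A)"
  let ?x = "vec_first v N" and ?y = "vec_last v (n * N)"
  have v: "v = ?x @\<^sub>v ?y" using Suc.prems(1) by simp
  have D: "?D \<in> carrier_mat (n * N) (n * N)" using diag_block_mat_replicate_carrier[OF A] .
  have Dv: "diag_block_mat (replicate (Suc n) A) *\<^sub>v v = (A *\<^sub>v ?x) @\<^sub>v (?D *\<^sub>v ?y)"
    by (subst v) (simp only: replicate_Suc diag_block_mat_Cons_mult_vec[OF A D vec_first_carrier vec_last_carrier])
  have x: "?x \<in> carrier_vec (1 * N)" "A *\<^sub>v ?x \<in> carrier_vec (1 * N)" using A by auto
  have y: "?y \<in> carrier_vec (n * N)" "?D *\<^sub>v ?y \<in> carrier_vec (n * N)" using D by auto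
  show ?case
  proof (cases "p = 1")
    case True
    have "block_vec N 1 v = ?x" "block_vec N 1 (diag_block_mat (replicate (Suc n) A) *\<^sub>v v) = A *\<^sub>v ?x"
      using block_vec_append_left[OF x(1), of 1 ?y] block_vec_append_left[OF x(2), of 1 "?D *\<^sub>v ?y"] x v Dv
      by (simp_all add: block_vec_single)
    then show ?thesis using True by simp
  next
    case False
    then obtain q where q: "p = 1 + q" "1 \<le> q" "q \<le> n"
      using Suc.prems(2,3) that[of "p - 1"] by fastforce
    have "block_vec N p v = block_vec N q ?y"
      "block_vec N p (diag_block_mat (replicate (Suc n) A) *\<^sub>v v) = block_vec N q (?D *\<^sub>v ?y)"
      using block_vec_append_right[OF x(1) y(1) q(2,3)] block_vec_append_right[OF x(2) y(2) q(2,3)] v Dv q(1)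
      by simp_all
    then show ?thesis using Suc.IH[OF y(1) q(2,3)] by simp
  qed
qed simp

lemma mult_zero_vec:
  fixes A :: "'k :: comm_ring_1 mat"
  shows "A \<in> carrier_mat m d \<Longrightarrow> A *\<^sub>v 0\<^sub>v d = 0\<^sub>v m"
  by (intro eq_vecI) auto

lemma block_vec_append4:
  assumes a: "a \<in> carrier_vec (m * N)" and x: "x \<in> carrier_vec N" and y: "y \<in> carrier_vec N"
    and c: "c \<in> carrier_vec (k * N)" and p: "1 \<le> p" "p \<le> m + (2 + k)"
  shows "block_vec N p (a @\<^sub>v ((x @\<^sub>v y) @\<^sub>v c)) =
    (if p \<le> m then block_vec N p a else if p = Suc m then x else if p = Suc (Suc m) then y
     else block_vec N (p - Suc (Suc m)) c)"
proof (cases "p \<le> m")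
  case True
  then show ?thesis using block_vec_append_left[OF a p(1)] by simp
next
  case False
  then obtain q where q: "p = m + q" "1 \<le> q" "q \<le> 2 + k"
    using p that[of "p - m"] by fastforce
  have x': "x \<in> carrier_vec (1 * N)" and y': "y \<in> carrier_vec (1 * N)" using x y by simp_all
  have xy: "x @\<^sub>v y \<in> carrier_vec (2 * N)" using append_carrier_vec[OF x y] by (simp add: mult_2)
  have xyc: "(x @\<^sub>v y) @\<^sub>v c \<in> carrier_vec ((2 + k) * N)"
    using append_carrier_vec[OF xy c] by (simp only: add_mult_distrib)
  note r = block_vec_append_right[OF a xyc q(2,3)]
  consider "q = 1" | "q = 1 + 1" | t where "q = 2 + t" "1 \<le> t" "t \<le> k"
    using q(2,3) by (metis add.commute add_le_cancel_left le_Suc_ex le_eq_less_or_eq less_eq_Suc_le one_add_one plus_1_eq_Suc Suc_leI)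
  then show ?thesis
  proof cases
    case 1
    then show ?thesis
      using r q(1) block_vec_append_left[OF xy, of 1 c] block_vec_append_left[OF x', of 1 y] x
      by (simp add: block_vec_single)
  next
    case 2
    then show ?thesis
      using r q(1) block_vec_append_left[OF xy, of 2 c] block_vec_append_right[OF x' y', of 1] y
      by (simp add: block_vec_single numeral_2_eq_2)
  next
    case (3 t)
    then show ?thesis
      using r q(1) block_vec_append_right[OF xy c 3(2,3)] by simp
  qed
qed

section \<open>The matrices of the braid generators\<close>

text \<open>
  The vector is cut at the same places as the block diagonal matrix, namely after \<open>i - 1\<close> and after
  \<open>i + 1\<close> blocks; the middle piece is then cut once more into its two blocks.
\<close>

lemma lm_sigma_right_factor:
  fixes g :: "nat \<Rightarrow> 'k :: field mat"
  assumes i: "1 \<le> i" "i < n" and g: "g i \<in> carrier_mat N N" "g (Suc i) \<in> carrier_mat N N"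
  defines "D \<equiv> diag_block_mat
       [1\<^sub>m (N * (i - 1)),
        four_block_mat (0\<^sub>m N N) (g i) (1\<^sub>m N) (1\<^sub>m N - g (Suc i)),
        1\<^sub>m (N * (n - i - 1))]"
  shows lm_sigma_right_factor_carrier: "D \<in> carrier_mat (n * N) (n * N)"
    and block_vec_lm_sigma_right_factor: "v \<in> carrier_vec (n * N) \<Longrightarrow> 1 \<le> p \<Longrightarrow> p \<le> n \<Longrightarrow>
      block_vec N p (D *\<^sub>v v) =
        (if p = i then g i *\<^sub>v block_vec N (Suc i) v
         else if p = Suc i then block_vec N i v + (block_vec N (Suc i) v - g (Suc i) *\<^sub>v block_vec N (Suc i) v)
         else block_vec N p v)"
proof -
  obtain m where m: "i = Suc m" using i by (metis Suc_le_D One_nat_def)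
  obtain k where k: "n = m + (2 + k)" using i(2) m by (metis less_iff_Suc_add add_Suc add_Suc_right add_2_eq_Suc)
  let ?R = "four_block_mat (0\<^sub>m N N) (g i) (1\<^sub>m N) (1\<^sub>m N - g (Suc i))"
  have R: "?R \<in> carrier_mat (2 * N) (2 * N)"
    unfolding mult_2 by (rule four_block_carrier_mat) (use g in auto)
  have D: "D = diag_block_mat [1\<^sub>m (m * N), ?R, 1\<^sub>m (k * N)]"
    by (simp add: D_def m k mult.commute del: diag_block_mat.simps)
  have c1: "diag_block_mat [1\<^sub>m (k * N)] \<in> carrier_mat (k * N) (k * N)"
    unfolding diag_block_mat_singleton by simp
  have c2: "diag_block_mat [?R, 1\<^sub>m (k * N)] \<in> carrier_mat ((2 + k) * N) ((2 + k) * N)"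
    using dim_diag_block_mat[of "[?R, 1\<^sub>m (k * N)]"] R
    by (intro carrier_matI) (auto simp: add_mult_distrib simp del: diag_block_mat.simps)
  show "D \<in> carrier_mat (n * N) (n * N)"
    unfolding D using dim_diag_block_mat[of "[1\<^sub>m (m * N), ?R, 1\<^sub>m (k * N)]"] R
    by (intro carrier_matI) (auto simp: k add_mult_distrib simp del: diag_block_mat.simps)
  assume v: "v \<in> carrier_vec (n * N)" and p: "1 \<le> p" "p \<le> n"
  define a where "a = vec_first v (m * N)"
  define r where "r = vec_last v ((2 + k) * N)"
  define xy where "xy = vec_first r (2 * N)"
  define c where "c = vec_last r (k * N)"
  define x where "x = vec_first xy N"
  define y where "y = vec_last xy N"
  have a: "a \<in> carrier_vec (m * N)" and c: "c \<in> carrier_vec (k * N)"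
    and x: "x \<in> carrier_vec N" and y: "y \<in> carrier_vec N"
    by (simp_all add: a_def c_def x_def y_def)
  have "v = a @\<^sub>v r" unfolding a_def r_def
    by (rule vec_first_last_append[symmetric]) (use v k in \<open>simp only: add_mult_distrib\<close>)
  also have "r = xy @\<^sub>v c" unfolding xy_def c_def
    by (rule vec_first_last_append[symmetric]) (simp add: r_def flip: add_mult_distrib)
  also have "xy = x @\<^sub>v y" unfolding x_def y_def
    by (rule vec_first_last_append[symmetric]) (simp add: xy_def flip: mult_2)
  finally have v_eq: "v = a @\<^sub>v ((x @\<^sub>v y) @\<^sub>v c)" .
  have xy: "x @\<^sub>v y \<in> carrier_vec (2 * N)" using append_carrier_vec[OF x y] by (simp only: mult_2)
  have xyc: "(x @\<^sub>v y) @\<^sub>v c \<in> carrier_vec ((2 + k) * N)"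
    using append_carrier_vec[OF xy c] by (simp only: add_mult_distrib)
  define x' where "x' = g i *\<^sub>v y"
  define y' where "y' = x + (y - g (Suc i) *\<^sub>v y)"
  have x': "x' \<in> carrier_vec N" and y': "y' \<in> carrier_vec N"
    using x y g by (auto simp: x'_def y'_def)
  have "0\<^sub>m N N *\<^sub>v x = 0\<^sub>v N" by (intro eq_vecI) (use x in auto)
  then have "?R *\<^sub>v (x @\<^sub>v y) = x' @\<^sub>v y'"
    using four_block_mat_mult_vec[of "0\<^sub>m N N" N N "g i" N "1\<^sub>m N" N "1\<^sub>m N - g (Suc i)" x y] g x y
      minus_carrier_mat[OF g(2)]
    by (simp add: x'_def y'_def minus_mult_distrib_mat_vec[of _ N N])
  moreover have "D *\<^sub>v v = a @\<^sub>v ((?R *\<^sub>v (x @\<^sub>v y)) @\<^sub>v c)"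
    using diag_block_mat_Cons_mult_vec[OF one_carrier_mat c2 a xyc] a c
      diag_block_mat_Cons_mult_vec[OF R c1 xy c]
    unfolding D v_eq by (simp only: diag_block_mat_singleton one_mult_mat_vec)
  ultimately have Dv: "D *\<^sub>v v = a @\<^sub>v ((x' @\<^sub>v y') @\<^sub>v c)" by simp
  have bv: "block_vec N q v = (if q \<le> m then block_vec N q a else if q = Suc m then x
      else if q = Suc (Suc m) then y else block_vec N (q - Suc (Suc m)) c)" if "1 \<le> q" "q \<le> n" for q
    using block_vec_append4[OF a x y c that[unfolded k]] v_eq by simp
  have "block_vec N p (D *\<^sub>v v) = (if p \<le> m then block_vec N p a else if p = Suc m then x'
      else if p = Suc (Suc m) then y' else block_vec N (p - Suc (Suc m)) c)"
    using block_vec_append4[OF a x' y' c p[unfolded k]] Dv by simp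
  then show "block_vec N p (D *\<^sub>v v) =
        (if p = i then g i *\<^sub>v block_vec N (Suc i) v
         else if p = Suc i then block_vec N i v + (block_vec N (Suc i) v - g (Suc i) *\<^sub>v block_vec N (Suc i) v)
         else block_vec N p v)"
    using bv[of p] bv[of i] bv[of "Suc i"] p by (simp add: m k x'_def y'_def)
qed

text \<open>
  The images of the generators under a representation of the semidirect product, reduced to the
  relations between them.
\<close>

locale long_moody_data =
  fixes n N :: nat and g s :: "nat \<Rightarrow> 'k :: field mat" and lam :: 'k
  assumes g_GL: "\<And>j. 1 \<le> j \<Longrightarrow> j \<le> n \<Longrightarrow> g j \<in> carrier (GL TYPE('k) N)"
    and s_GL: "\<And>i. 1 \<le> i \<Longrightarrow> i < n \<Longrightarrow> s i \<in> carrier (GL TYPE('k) N)"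
    and s_g: "\<And>i. 1 \<le> i \<Longrightarrow> i < n \<Longrightarrow> s i * g i = g (Suc i) * s i"
    and s_g_Suc: "\<And>i. 1 \<le> i \<Longrightarrow> i < n \<Longrightarrow> g (Suc i) * (s i * g (Suc i)) = g i * (g (Suc i) * s i)"
    and s_g_other: "\<And>i j. 1 \<le> i \<Longrightarrow> i < n \<Longrightarrow> 1 \<le> j \<Longrightarrow> j \<le> n \<Longrightarrow> j \<noteq> i \<Longrightarrow> j \<noteq> Suc i \<Longrightarrow>
      s i * g j = g j * s i"
    and s_adjacent: "\<And>i. 1 \<le> i \<Longrightarrow> Suc i < n \<Longrightarrow> s i * s (Suc i) * s i = s (Suc i) * s i * s (Suc i)"
    and s_far: "\<And>i j. 1 \<le> i \<Longrightarrow> i + 2 \<le> j \<Longrightarrow> j < n \<Longrightarrow> s i * s j = s j * s i"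
    and lam_nonzero: "lam \<noteq> 0"
begin

lemma g_mat [simp]: "1 \<le> j \<Longrightarrow> j \<le> n \<Longrightarrow> g j \<in> carrier_mat N N"
  using GL_carrier_mat[OF g_GL] .

lemma s_mat [simp]: "1 \<le> i \<Longrightarrow> i < n \<Longrightarrow> s i \<in> carrier_mat N N"
  using GL_carrier_mat[OF s_GL] .

lemma g_vec [simp]: "1 \<le> j \<Longrightarrow> j \<le> n \<Longrightarrow> w \<in> carrier_vec N \<Longrightarrow> g j *\<^sub>v w \<in> carrier_vec N"
  using mult_mat_vec_carrier[OF g_mat] .

lemma s_vec [simp]: "1 \<le> i \<Longrightarrow> i < n \<Longrightarrow> w \<in> carrier_vec N \<Longrightarrow> s i *\<^sub>v w \<in> carrier_vec N"
  using mult_mat_vec_carrier[OF s_mat] .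

context
  fixes w :: "'k vec"
  assumes w: "w \<in> carrier_vec N"
begin

lemma s_g_vec: "1 \<le> i \<Longrightarrow> i < n \<Longrightarrow> s i *\<^sub>v (g i *\<^sub>v w) = g (Suc i) *\<^sub>v (s i *\<^sub>v w)"
  using arg_cong[OF s_g[of i], of "\<lambda>A. A *\<^sub>v w"] w
  by (simp add: assoc_mult_mat_vec[of _ N N _ N] less_imp_le)

lemma s_g_Suc_vec: "1 \<le> i \<Longrightarrow> i < n \<Longrightarrow>
    g (Suc i) *\<^sub>v (s i *\<^sub>v (g (Suc i) *\<^sub>v w)) = g i *\<^sub>v (g (Suc i) *\<^sub>v (s i *\<^sub>v w))"
  using arg_cong[OF s_g_Suc[of i], of "\<lambda>A. A *\<^sub>v w"] w g_mat[of "Suc i"] g_mat[of i] s_mat[of i]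
  by (simp add: assoc_mult_mat_vec[of _ N N _ N] mult_carrier_mat[of _ N N _ N] del: g_mat)

lemma s_g_other_vec: "1 \<le> i \<Longrightarrow> i < n \<Longrightarrow> 1 \<le> j \<Longrightarrow> j \<le> n \<Longrightarrow> j \<noteq> i \<Longrightarrow> j \<noteq> Suc i \<Longrightarrow>
    s i *\<^sub>v (g j *\<^sub>v w) = g j *\<^sub>v (s i *\<^sub>v w)"
  using arg_cong[OF s_g_other[of i j], of "\<lambda>A. A *\<^sub>v w"] w by (simp add: assoc_mult_mat_vec[of _ N N _ N])

lemma s_adjacent_vec: "1 \<le> i \<Longrightarrow> Suc i < n \<Longrightarrow>
    s i *\<^sub>v (s (Suc i) *\<^sub>v (s i *\<^sub>v w)) = s (Suc i) *\<^sub>v (s i *\<^sub>v (s (Suc i) *\<^sub>v w))"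
  using arg_cong[OF s_adjacent[of i], of "\<lambda>A. A *\<^sub>v w"] w
  by (simp add: assoc_mult_mat_vec[of _ N N _ N] mult_carrier_mat[of _ N N _ N])

lemma s_far_vec: "1 \<le> i \<Longrightarrow> i + 2 \<le> j \<Longrightarrow> j < n \<Longrightarrow> s i *\<^sub>v (s j *\<^sub>v w) = s j *\<^sub>v (s i *\<^sub>v w)"
  using arg_cong[OF s_far[of i j], of "\<lambda>A. A *\<^sub>v w"] w by (simp add: assoc_mult_mat_vec[of _ N N _ N])

lemma g_eq_0: "1 \<le> j \<Longrightarrow> j \<le> n \<Longrightarrow> g j *\<^sub>v w = 0\<^sub>v N \<Longrightarrow> w = 0\<^sub>v N"
  using GL_injective[OF g_GL w zero_carrier_vec, of j] mult_zero_vec[OF g_mat, of j] by simp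

lemma s_eq_0: "1 \<le> i \<Longrightarrow> i < n \<Longrightarrow> s i *\<^sub>v w = 0\<^sub>v N \<Longrightarrow> w = 0\<^sub>v N"
  using GL_injective[OF s_GL w zero_carrier_vec, of i] mult_zero_vec[OF s_mat, of i] by simp

end

abbreviation \<sigma> :: "nat \<Rightarrow> 'k mat" where
  "\<sigma> \<equiv> lm_sigma n N g s"

lemma sigma_carrier [simp]: "1 \<le> i \<Longrightarrow> i < n \<Longrightarrow> \<sigma> i \<in> carrier_mat (n * N) (n * N)"
  unfolding lm_sigma_def
  by (rule mult_carrier_mat[OF diag_block_mat_replicate_carrier lm_sigma_right_factor_carrier]) auto

lemma sigma_vec [simp]: "1 \<le> i \<Longrightarrow> i < n \<Longrightarrow> v \<in> carrier_vec (n * N) \<Longrightarrow> \<sigma> i *\<^sub>v v \<in> carrier_vec (n * N)"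
  using mult_mat_vec_carrier[OF sigma_carrier] .

lemma block_vec_sigma:
  assumes i: "1 \<le> i" "i < n" and v: "v \<in> carrier_vec (n * N)" and p: "1 \<le> p" "p \<le> n"
  shows "block_vec N p (\<sigma> i *\<^sub>v v) =
    (if p = i then s i *\<^sub>v (g i *\<^sub>v block_vec N (Suc i) v)
     else if p = Suc i then
       s i *\<^sub>v (block_vec N i v + (block_vec N (Suc i) v - g (Suc i) *\<^sub>v block_vec N (Suc i) v))
     else s i *\<^sub>v block_vec N p v)"
proof -
  have g: "g i \<in> carrier_mat N N" "g (Suc i) \<in> carrier_mat N N" using i by auto
  note D = lm_sigma_right_factor_carrier[where g = g, OF i g]
  have "block_vec N p (\<sigma> i *\<^sub>v v) = s i *\<^sub>v block_vec N p (diag_block_mat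
       [1\<^sub>m (N * (i - 1)), four_block_mat (0\<^sub>m N N) (g i) (1\<^sub>m N) (1\<^sub>m N - g (Suc i)),
        1\<^sub>m (N * (n - i - 1))] *\<^sub>v v)"
    unfolding lm_sigma_def
    using assoc_mult_mat_vec[OF diag_block_mat_replicate_carrier[OF s_mat[OF i]] D v]
      block_vec_diag_replicate[OF s_mat[OF i] mult_mat_vec_carrier[OF D v] p] by simp
  then show ?thesis using block_vec_lm_sigma_right_factor[where g = g, OF i g v p] by simp
qed

text \<open>
  If the image of \<open>v\<close> vanishes, block \<open>i\<close> of the image shows that \<open>v\<^sub>i\<^sub>+\<^sub>1\<close> vanishes, and then block
  \<open>i + 1\<close> of the image shows that \<open>v\<^sub>i\<close> does.
\<close>

lemma sigma_GL:
  assumes i: "1 \<le> i" "i < n"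
  shows "\<sigma> i \<in> carrier (GL TYPE('k) (n * N))"
proof (rule GL_injectiveI[OF sigma_carrier[OF i]])
  fix v :: "'k vec" assume v: "v \<in> carrier_vec (n * N)" and 0: "\<sigma> i *\<^sub>v v = 0\<^sub>v (n * N)"
  have *: "block_vec N p (\<sigma> i *\<^sub>v v) = 0\<^sub>v N" if "1 \<le> p" "p \<le> n" for p
    using block_vec_zero[OF that] 0 by simp
  have "s i *\<^sub>v (g i *\<^sub>v block_vec N (Suc i) v) = 0\<^sub>v N"
    using *[of i] block_vec_sigma[OF i v, of i] i by simp
  then have "g i *\<^sub>v block_vec N (Suc i) v = 0\<^sub>v N"
    by (rule s_eq_0[OF _ i, rotated]) (use i in simp)
  then have y: "block_vec N (Suc i) v = 0\<^sub>v N"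
    by (rule g_eq_0[of _ i, rotated 3]) (use i in simp_all)
  have "s i *\<^sub>v (block_vec N i v + (block_vec N (Suc i) v - g (Suc i) *\<^sub>v block_vec N (Suc i) v)) = 0\<^sub>v N"
    using *[of "Suc i"] block_vec_sigma[OF i v, of "Suc i"] i by simp
  moreover have "g (Suc i) *\<^sub>v 0\<^sub>v N = 0\<^sub>v N"
    using mult_zero_vec[OF g_mat[of "Suc i"]] i by simp
  ultimately have x: "block_vec N i v = 0\<^sub>v N"
    using s_eq_0[OF block_vec_carrier(1) i, of i v] by (simp add: y)
  show "v = 0\<^sub>v (n * N)"
  proof (rule block_vec_eqI[OF v zero_carrier_vec])
    fix p assume p: "1 \<le> p" "p \<le> n"
    have "block_vec N p v = 0\<^sub>v N"
      using *[OF p] block_vec_sigma[OF i v p] x y s_eq_0[OF _ i, of "block_vec N p v"]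
      by (cases "p = i"; cases "p = Suc i") auto
    then show "block_vec N p v = block_vec N p (0\<^sub>v (n * N))" by (simp add: block_vec_zero[OF p])
  qed
qed

lemmas s_distrib = mult_add_distrib_mat_vec[of _ N N] mult_minus_distrib_mat_vec[of _ N N]

lemma sigma_far:
  assumes ij: "1 \<le> i" "i + 2 \<le> j" "j < n"
  shows "\<sigma> i * \<sigma> j = \<sigma> j * \<sigma> i"
proof (rule mat_eqI_mult_vec[where m = "n * N" and d = "n * N"])
  fix v :: "'k vec" assume v: "v \<in> carrier_vec (n * N)"
  have ij': "1 \<le> i" "i < n" "1 \<le> j" "j < n" "j \<noteq> i" "j \<noteq> Suc i" "i \<noteq> Suc j" "Suc i \<noteq> Suc j" using ij by auto
  have "\<sigma> i *\<^sub>v (\<sigma> j *\<^sub>v v) = \<sigma> j *\<^sub>v (\<sigma> i *\<^sub>v v)"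
  proof (rule block_vec_eqI)
    fix p assume p: "1 \<le> p" "p \<le> n"
    have far: "s i *\<^sub>v (s j *\<^sub>v w) = s j *\<^sub>v (s i *\<^sub>v w)" if "w \<in> carrier_vec N" for w
      using s_far_vec[OF that] ij by simp
    have sg: "s i *\<^sub>v (g j *\<^sub>v w) = g j *\<^sub>v (s i *\<^sub>v w)" "s i *\<^sub>v (g (Suc j) *\<^sub>v w) = g (Suc j) *\<^sub>v (s i *\<^sub>v w)"
      "s j *\<^sub>v (g i *\<^sub>v w) = g i *\<^sub>v (s j *\<^sub>v w)" "s j *\<^sub>v (g (Suc i) *\<^sub>v w) = g (Suc i) *\<^sub>v (s j *\<^sub>v w)"
      if "w \<in> carrier_vec N" for w
      using that ij by (auto intro!: s_g_other_vec)
    show "block_vec N p (\<sigma> i *\<^sub>v (\<sigma> j *\<^sub>v v)) = block_vec N p (\<sigma> j *\<^sub>v (\<sigma> i *\<^sub>v v))"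
      using ij' p v
      by (simp add: block_vec_sigma far sg[symmetric] s_distrib)
  qed (use ij' v in auto)
  then show "(\<sigma> i * \<sigma> j) *\<^sub>v v = (\<sigma> j * \<sigma> i) *\<^sub>v v"
    using ij' v by (simp add: assoc_mult_mat_vec[of _ "n * N" "n * N" _ "n * N"])
qed (use ij in \<open>simp_all add: mult_carrier_mat[of _ "n * N" "n * N" _ "n * N"]\<close>)

text \<open>
  The braid relation is checked on the three blocks \<open>x, y, z\<close> in positions \<open>i, i + 1, i + 2\<close>; on all
  other blocks it is the braid relation of the \<open>s\<^sub>i\<close>. Each block of the two triple products is a
  signed sum of words in \<open>S, T, A, B, C\<close> applied to \<open>x\<close>, \<open>y\<close> or \<open>z\<close>, and the facts \<open>E1\<close> to \<open>E7\<close>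
  match these words. The rules used are \<open>S A = B S\<close>, \<open>S C = C S\<close>, \<open>T B = C T\<close>, \<open>C T C = B C T\<close>
  and \<open>T S T = S T S\<close>. They are not confluent, so their directions are chosen for each word.
\<close>

lemma sigma_adjacent:
  assumes i: "1 \<le> i" "Suc i < n"
  shows "\<sigma> i * \<sigma> (Suc i) * \<sigma> i = \<sigma> (Suc i) * \<sigma> i * \<sigma> (Suc i)"
proof (rule mat_eqI_mult_vec[where m = "n * N" and d = "n * N"])
  fix v :: "'k vec" assume v: "v \<in> carrier_vec (n * N)"
  define S T A B C where "S = s i" "T = s (Suc i)" "A = g i" "B = g (Suc i)" "C = g (Suc (Suc i))"
  note STABC = S_T_A_B_C_def
  define x y z where "x = block_vec N i v" "y = block_vec N (Suc i) v" "z = block_vec N (Suc (Suc i)) v"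
  have xyz: "x \<in> carrier_vec N" "y \<in> carrier_vec N" "z \<in> carrier_vec N" by (simp_all add: x_y_z_def)
  have i': "i < n" "1 \<le> Suc i" "Suc (Suc i) \<le> n" "i \<le> n" "Suc i \<le> n" "1 \<le> Suc (Suc i)" using i by auto
  have M: "S \<in> carrier_mat N N" "T \<in> carrier_mat N N" "A \<in> carrier_mat N N" "B \<in> carrier_mat N N" "C \<in> carrier_mat N N"
    using i i' unfolding STABC by (auto simp del: One_nat_def)
  note dims = M[THEN carrier_matD(1)]
  have V: "S *\<^sub>v w \<in> carrier_vec N" "T *\<^sub>v w \<in> carrier_vec N" "A *\<^sub>v w \<in> carrier_vec N"
    "B *\<^sub>v w \<in> carrier_vec N" "C *\<^sub>v w \<in> carrier_vec N" if "w \<in> carrier_vec N" for w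
    using that M by auto
  have SA: "S *\<^sub>v (A *\<^sub>v w) = B *\<^sub>v (S *\<^sub>v w)" and SC: "S *\<^sub>v (C *\<^sub>v w) = C *\<^sub>v (S *\<^sub>v w)"
    and TB: "T *\<^sub>v (B *\<^sub>v w) = C *\<^sub>v (T *\<^sub>v w)"
    and CTC: "C *\<^sub>v (T *\<^sub>v (C *\<^sub>v w)) = B *\<^sub>v (C *\<^sub>v (T *\<^sub>v w))"
    and TST: "T *\<^sub>v (S *\<^sub>v (T *\<^sub>v w)) = S *\<^sub>v (T *\<^sub>v (S *\<^sub>v w))"
    if "w \<in> carrier_vec N" for w
    using s_g_vec[OF that, of i] s_g_other_vec[OF that, of i "Suc (Suc i)"] s_g_vec[OF that, of "Suc i"]
      s_g_Suc_vec[OF that, of "Suc i"] s_adjacent_vec[OF that, of i] i i'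
    unfolding STABC by simp_all
  have E1: "S *\<^sub>v (A *\<^sub>v (T *\<^sub>v (B *\<^sub>v (S *\<^sub>v w)))) = T *\<^sub>v (S *\<^sub>v (A *\<^sub>v (T *\<^sub>v (B *\<^sub>v w))))"
    and E2: "S *\<^sub>v (T *\<^sub>v (S *\<^sub>v (A *\<^sub>v w))) = T *\<^sub>v (B *\<^sub>v (S *\<^sub>v (T *\<^sub>v w)))"
    and E3: "S *\<^sub>v (T *\<^sub>v (B *\<^sub>v (S *\<^sub>v w))) = T *\<^sub>v (B *\<^sub>v (S *\<^sub>v (T *\<^sub>v w)))"
    if w: "w \<in> carrier_vec N" for w
    using w by (simp_all add: V SA SC TB CTC TST)
  have E4: "T *\<^sub>v (C *\<^sub>v (S *\<^sub>v (T *\<^sub>v w))) = S *\<^sub>v (T *\<^sub>v (S *\<^sub>v (B *\<^sub>v w)))"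
    and E5: "S *\<^sub>v (T *\<^sub>v (C *\<^sub>v (S *\<^sub>v w))) = T *\<^sub>v (S *\<^sub>v (T *\<^sub>v (C *\<^sub>v w)))"
    if w: "w \<in> carrier_vec N" for w
    using w by (simp_all add: V TST flip: SC TB)
  have E6: "S *\<^sub>v (T *\<^sub>v (S *\<^sub>v (B *\<^sub>v (C *\<^sub>v w)))) = T *\<^sub>v (S *\<^sub>v (B *\<^sub>v (T *\<^sub>v (B *\<^sub>v w))))"
    if w: "w \<in> carrier_vec N" for w
  proof -
    have "S *\<^sub>v (T *\<^sub>v (S *\<^sub>v (B *\<^sub>v (C *\<^sub>v w)))) = T *\<^sub>v (C *\<^sub>v (S *\<^sub>v (T *\<^sub>v (C *\<^sub>v w))))"
      using w by (simp add: V E4)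
    also have "\<dots> = T *\<^sub>v (S *\<^sub>v (B *\<^sub>v (T *\<^sub>v (B *\<^sub>v w))))"
      using w by (simp add: V TB CTC flip: SC)
    finally show ?thesis .
  qed
  have E7: "S *\<^sub>v (B *\<^sub>v (T *\<^sub>v (B *\<^sub>v (S *\<^sub>v w)))) = T *\<^sub>v (B *\<^sub>v (S *\<^sub>v (T *\<^sub>v (C *\<^sub>v w))))"
    if w: "w \<in> carrier_vec N" for w
  proof -
    have "S *\<^sub>v (B *\<^sub>v (T *\<^sub>v (B *\<^sub>v (S *\<^sub>v w)))) = S *\<^sub>v (C *\<^sub>v (T *\<^sub>v (C *\<^sub>v (S *\<^sub>v w))))"
      using w by (simp add: V TB CTC)
    also have "\<dots> = C *\<^sub>v (S *\<^sub>v (T *\<^sub>v (S *\<^sub>v (C *\<^sub>v w))))" using w by (simp add: V SC)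
    also have "\<dots> = T *\<^sub>v (B *\<^sub>v (S *\<^sub>v (T *\<^sub>v (C *\<^sub>v w))))" using w by (simp add: V TB TST)
    finally show ?thesis .
  qed
  have "\<sigma> i *\<^sub>v (\<sigma> (Suc i) *\<^sub>v (\<sigma> i *\<^sub>v v)) = \<sigma> (Suc i) *\<^sub>v (\<sigma> i *\<^sub>v (\<sigma> (Suc i) *\<^sub>v v))"
  proof (rule block_vec_eqI)
    fix p assume p: "1 \<le> p" "p \<le> n"
    consider "p = i" | "p = Suc i" | "p = Suc (Suc i)" | "p \<noteq> i" "p \<noteq> Suc i" "p \<noteq> Suc (Suc i)" by blast
    then show "block_vec N p (\<sigma> i *\<^sub>v (\<sigma> (Suc i) *\<^sub>v (\<sigma> i *\<^sub>v v))) =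
      block_vec N p (\<sigma> (Suc i) *\<^sub>v (\<sigma> i *\<^sub>v (\<sigma> (Suc i) *\<^sub>v v)))"
    proof cases
      case 1
      have "S *\<^sub>v (A *\<^sub>v (T *\<^sub>v (B *\<^sub>v (S *\<^sub>v z)))) = T *\<^sub>v (S *\<^sub>v (A *\<^sub>v (T *\<^sub>v (B *\<^sub>v z))))"
        using E1 xyz by simp
      with 1 i i' v show ?thesis
        by (simp add: block_vec_sigma STABC x_y_z_def del: One_nat_def)
    next
      case 2
      have "S *\<^sub>v (T *\<^sub>v (S *\<^sub>v (A *\<^sub>v y)) + (T *\<^sub>v (B *\<^sub>v (S *\<^sub>v z)) - B *\<^sub>v (T *\<^sub>v (B *\<^sub>v (S *\<^sub>v z))))) =
        T *\<^sub>v (B *\<^sub>v (S *\<^sub>v (T *\<^sub>v (y + (z - C *\<^sub>v z)))))"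
        by (intro eq_vecI) (use xyz in \<open>simp_all add: V M s_distrib E2 E3 E7 dims del: index_mult_mat_vec\<close>)
      with 2 i i' v show ?thesis
        by (simp add: block_vec_sigma STABC x_y_z_def del: One_nat_def)
    next
      case 3
      let ?u = "S *\<^sub>v (T *\<^sub>v (y + (z - C *\<^sub>v z)))"
      have "S *\<^sub>v (T *\<^sub>v (S *\<^sub>v (x + (y - B *\<^sub>v y)) + (S *\<^sub>v z - C *\<^sub>v (S *\<^sub>v z)))) =
        T *\<^sub>v (S *\<^sub>v (T *\<^sub>v x + (T *\<^sub>v (B *\<^sub>v z) - B *\<^sub>v (T *\<^sub>v (B *\<^sub>v z)))) + (?u - C *\<^sub>v ?u))"
        by (intro eq_vecI) (use xyz in \<open>simp_all add: V M s_distrib E4 E5 E6 TST dims del: index_mult_mat_vec\<close>)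
      with 3 i i' v show ?thesis
        by (simp add: block_vec_sigma STABC x_y_z_def del: One_nat_def)
    next
      case 4
      with i i' v p show ?thesis
        by (simp add: block_vec_sigma s_adjacent_vec del: One_nat_def)
    qed
  qed (use i i' v in auto)
  then show "(\<sigma> i * \<sigma> (Suc i) * \<sigma> i) *\<^sub>v v = (\<sigma> (Suc i) * \<sigma> i * \<sigma> (Suc i)) *\<^sub>v v"
    using i i' v by (simp add: assoc_mult_mat_vec[of _ "n * N" "n * N" _ "n * N"]
      mult_carrier_mat[of _ "n * N" "n * N" _ "n * N"] del: One_nat_def)
qed (use i in \<open>simp_all add: mult_carrier_mat[of _ "n * N" "n * N" _ "n * N"]\<close>)

end

section \<open>Common fixed vectors of the free generators\<close>

lemma vec_eq_pointwise:
  "v \<in> carrier_vec N \<Longrightarrow> w \<in> carrier_vec N \<Longrightarrow> v = w \<longleftrightarrow> (\<forall>a<N. v $ a = w $ a)"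
  by (auto intro: eq_vecI)

text \<open>
  A scalar form of the fixed point equations, with \<open>u\<^sub>q\<close> a coordinate of \<open>g\<^sub>q v\<^sub>q\<close> and \<open>w\<^sub>q\<close> the same
  coordinate of \<open>v\<^sub>q\<close>. The summands of equations \<open>j\<close> and \<open>j + 1\<close> differ only for \<open>q = j\<close> and
  \<open>q = j + 1\<close>, so the difference of the two equations is \<open>(\<lambda> - 1) (w\<^sub>j - u\<^sub>j\<^sub>+\<^sub>1)\<close>, and \<open>\<lambda> - 1\<close> can be
  cancelled. Once \<open>w\<^sub>j = u\<^sub>j\<^sub>+\<^sub>1\<close> is known, the sum in equation \<open>n\<close> telescopes.
\<close>

lemma telescoped_system:
  fixes u w :: "nat \<Rightarrow> 'a :: field"
  assumes n: "1 \<le> n" and lam: "lam \<noteq> 1"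
  shows "(\<forall>j. 1 \<le> j \<and> j \<le> n \<longrightarrow>
      (\<Sum>q=1..n. if q < j then lam * (u q - w q) else if q = j then lam * u q else u q - w q) = w j) \<longleftrightarrow>
    (\<forall>j. 1 \<le> j \<and> j < n \<longrightarrow> w j = u (Suc j)) \<and> lam * u 1 = w n"
proof -
  define f where "f j q = (if q < j then lam * (u q - w q) else if q = j then lam * u q else u q - w q)" for j q
  define T where "T j = (\<Sum>q=1..n. f j q) - w j" for j
  have step: "T j - T (Suc j) = (lam - 1) * (w j - u (Suc j))" if j: "1 \<le> j" "j < n" for j
  proof -
    have "(\<Sum>q=1..n. f j q) - (\<Sum>q=1..n. f (Suc j) q) =
      (\<Sum>q=1..n. (if q = j then lam * w j else 0) + (if q = Suc j then (1 - lam) * u (Suc j) - w (Suc j) else 0))"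
      unfolding sum_subtractf[symmetric] by (rule sum.cong) (auto simp: f_def algebra_simps)
    also have "\<dots> = lam * w j + ((1 - lam) * u (Suc j) - w (Suc j))"
      unfolding sum.distrib using j by simp
    finally show ?thesis by (simp add: T_def algebra_simps)
  qed
  have last: "T n = lam * u 1 - w n" if w: "\<And>j. 1 \<le> j \<Longrightarrow> j < n \<Longrightarrow> w j = u (Suc j)"
  proof -
    obtain m where m: "n = Suc m" using n by (metis Suc_le_D One_nat_def)
    have "(\<Sum>q=1..m. u q - u (Suc q)) = u 1 - u n"
      using sum_Suc_diff[of 1 m u] by (simp add: m sum_subtractf algebra_simps)
    moreover have "(\<Sum>q=1..m. f n q) = (\<Sum>q=1..m. lam * (u q - u (Suc q)))"
      by (rule sum.cong) (auto simp: f_def m w)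
    ultimately have "(\<Sum>q=1..m. f n q) = lam * (u 1 - u n)"
      by (simp only: sum_distrib_left[symmetric])
    then show ?thesis by (simp add: T_def m f_def algebra_simps)
  qed
  have "(\<forall>j. 1 \<le> j \<and> j \<le> n \<longrightarrow> T j = 0) \<longleftrightarrow>
    (\<forall>j. 1 \<le> j \<and> j < n \<longrightarrow> w j = u (Suc j)) \<and> lam * u 1 = w n" (is "?L \<longleftrightarrow> ?R")
  proof
    assume L: ?L
    have "w j = u (Suc j)" if "1 \<le> j" "j < n" for j
      using step[OF that] L that lam by simp
    then show ?R using last L n by auto
  next
    assume R: ?R
    have "T j = 0" if "1 \<le> j" "j \<le> n" for j
      using that(2,1)
    proof (induction j rule: inc_induct)
      case base
      then show ?case using last R by simp
    next
      case (step j)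
      then show ?case using \<open>1 \<le> j \<Longrightarrow> j < n \<Longrightarrow> T j - T (Suc j) = _\<close> R by simp
    qed
    then show ?L by blast
  qed
  then show ?thesis by (simp add: T_def f_def)
qed

context long_moody_data
begin

abbreviation \<xi> :: "nat \<Rightarrow> 'k mat" where
  "\<xi> \<equiv> lm_x n N lam g"

lemma xi_carrier [simp]: "\<xi> j \<in> carrier_mat (n * N) (n * N)"
  by (simp add: lm_x_def)

lemma block_vec_xi:
  assumes j: "1 \<le> j" "j \<le> n" and v: "v \<in> carrier_vec (n * N)" and p: "1 \<le> p" "p \<le> n" and a: "a < N"
  shows "block_vec N p (\<xi> j *\<^sub>v v) $ a =
    (if p = j then
       \<Sum>q=1..n. if q < j then lam * ((g q *\<^sub>v block_vec N q v) $ a - block_vec N q v $ a)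
         else if q = j then lam * (g q *\<^sub>v block_vec N q v) $ a
         else (g q *\<^sub>v block_vec N q v) $ a - block_vec N q v $ a
     else block_vec N p v $ a)"
proof -
  define B where "B p q = (if p = j then
               if q < j then lam \<cdot>\<^sub>m (g q - 1\<^sub>m N)
               else if q = j then lam \<cdot>\<^sub>m g q
               else g q - 1\<^sub>m N
             else if p = q then 1\<^sub>m N else 0\<^sub>m N N)" for p q
  have B: "B p q \<in> carrier_mat N N" if "1 \<le> q" "q \<le> n" for p q
    using that by (auto simp: B_def intro!: minus_carrier_mat)
  have zero: "(0\<^sub>m N N *\<^sub>v x) $ a = 0" if "x \<in> carrier_vec N" for x :: "'k vec"
    using that a by simp
  have sm: "((c \<cdot>\<^sub>m A) *\<^sub>v x) $ a = c * (A *\<^sub>v x) $ a" if "A \<in> carrier_mat N N" "x \<in> carrier_vec N"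
    for c and x :: "'k vec" and A
    using that a by (simp add: row_smult)
  have minus: "((g q - 1\<^sub>m N) *\<^sub>v x) $ a = (g q *\<^sub>v x) $ a - x $ a"
    if "1 \<le> q" "q \<le> n" "x \<in> carrier_vec N" for q x
    using that a minus_mult_distrib_mat_vec[OF g_mat[OF that(1,2)] one_carrier_mat that(3)] by simp
  have "block_vec N p (\<xi> j *\<^sub>v v) $ a = (\<Sum>q=1..n. (B p q *\<^sub>v block_vec N q v) $ a)"
    unfolding lm_x_def using block_mat_mult_vec[where B = B, OF p B v a] by (simp add: B_def[abs_def])
  also have "\<dots> = (if p = j then
       \<Sum>q=1..n. if q < j then lam * ((g q *\<^sub>v block_vec N q v) $ a - block_vec N q v $ a)
         else if q = j then lam * (g q *\<^sub>v block_vec N q v) $ a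
         else (g q *\<^sub>v block_vec N q v) $ a - block_vec N q v $ a
     else block_vec N p v $ a)"
  proof (cases "p = j")
    case True
    have row_j: "(B p q *\<^sub>v block_vec N q v) $ a =
        (if q < j then lam * ((g q *\<^sub>v block_vec N q v) $ a - block_vec N q v $ a)
         else if q = j then lam * (g q *\<^sub>v block_vec N q v) $ a
         else (g q *\<^sub>v block_vec N q v) $ a - block_vec N q v $ a)" if "q \<in> {1..n}" for q
      using that True sm[of "g q - 1\<^sub>m N" "block_vec N q v" lam] sm[of "g q" "block_vec N q v" lam] minus[of q "block_vec N q v"]
      by (cases "q < j"; cases "q = j") (auto simp: B_def minus_carrier_mat)
    show ?thesis unfolding if_P[OF True] by (rule sum.cong[OF HOL.refl]) (rule row_j)
  next
    case False
    have "(\<Sum>q=1..n. (B p q *\<^sub>v block_vec N q v) $ a) = (\<Sum>q=1..n. if q = p then block_vec N p v $ a else 0)"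
      by (rule sum.cong) (use False zero in \<open>auto simp: B_def\<close>)
    then show ?thesis using False p by simp
  qed
  finally show ?thesis .
qed

text \<open>
  A vector in the kernel vanishes outside block \<open>j\<close>, and block row \<open>j\<close> then reads
  \<open>\<lambda> g\<^sub>j v\<^sub>j = 0\<close>.
\<close>

lemma xi_GL:
  assumes j: "1 \<le> j" "j \<le> n"
  shows "\<xi> j \<in> carrier (GL TYPE('k) (n * N))"
proof (rule GL_injectiveI[OF xi_carrier])
  fix v :: "'k vec" assume v: "v \<in> carrier_vec (n * N)" and 0: "\<xi> j *\<^sub>v v = 0\<^sub>v (n * N)"
  have *: "block_vec N p (\<xi> j *\<^sub>v v) = 0\<^sub>v N" if "1 \<le> p" "p \<le> n" for p
    using block_vec_zero[OF that] 0 by simp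
  have other: "block_vec N p v = 0\<^sub>v N" if p: "1 \<le> p" "p \<le> n" "p \<noteq> j" for p
  proof (rule eq_vecI)
    fix a assume "a < dim_vec (0\<^sub>v N :: 'k vec)"
    then show "block_vec N p v $ a = 0\<^sub>v N $ a"
      using block_vec_xi[OF j v p(1,2), of a] *[OF p(1,2)] p(3) by simp
  qed simp
  have g0: "(g q *\<^sub>v 0\<^sub>v N) $ a = 0" if "1 \<le> q" "q \<le> n" "a < N" for q a
    using mult_zero_vec[OF g_mat[OF that(1,2)]] that(3) by simp
  have "g j *\<^sub>v block_vec N j v = 0\<^sub>v N"
  proof (rule eq_vecI)
    fix a assume "a < dim_vec (0\<^sub>v N :: 'k vec)"
    then have a: "a < N" by simp
    have "(\<Sum>q=1..n. if q < j then lam * ((g q *\<^sub>v block_vec N q v) $ a - block_vec N q v $ a)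
         else if q = j then lam * (g q *\<^sub>v block_vec N q v) $ a
         else (g q *\<^sub>v block_vec N q v) $ a - block_vec N q v $ a) =
       (\<Sum>q=1..n. if q = j then lam * (g j *\<^sub>v block_vec N j v) $ a else 0)"
      by (rule sum.cong) (use a g0 other in auto)
    then have "lam * (g j *\<^sub>v block_vec N j v) $ a = 0"
      using block_vec_xi[OF j v j a] *[OF j] a j by simp
    then show "(g j *\<^sub>v block_vec N j v) $ a = 0\<^sub>v N $ a" using lam_nonzero a by simp
  qed (use carrier_matD(1)[OF g_mat[OF j]] in simp)
  then have "block_vec N j v = 0\<^sub>v N" using g_eq_0[OF block_vec_carrier(1) j] by simp
  with other have "block_vec N p v = 0\<^sub>v N" if "1 \<le> p" "p \<le> n" for p using that by blast
  then show "v = 0\<^sub>v (n * N)"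
    by (intro block_vec_eqI[OF v zero_carrier_vec]) (simp add: block_vec_zero)
qed

lemma xi_fixed_iff:
  assumes n: "1 \<le> n" and lam: "lam \<noteq> 1" and v: "v \<in> carrier_vec (n * N)"
  shows "(\<forall>j\<in>{1..n}. \<xi> j *\<^sub>v v = v) \<longleftrightarrow>
    (\<forall>j. 1 \<le> j \<and> j < n \<longrightarrow> block_vec N j v = g (Suc j) *\<^sub>v block_vec N (Suc j) v) \<and>
    lam \<cdot>\<^sub>v (g 1 *\<^sub>v block_vec N 1 v) = block_vec N n v"
proof -
  define u where "u a q = (g q *\<^sub>v block_vec N q v) $ a" for a q
  define w where "w a q = block_vec N q v $ a" for a q
  let ?f = "\<lambda>a j. \<Sum>q=1..n. if q < j then lam * (u a q - w a q) else if q = j then lam * u a q else u a q - w a q"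
  have fixed: "\<xi> j *\<^sub>v v = v \<longleftrightarrow> (\<forall>a<N. ?f a j = w a j)" if j: "1 \<le> j" "j \<le> n" for j
  proof
    assume "\<xi> j *\<^sub>v v = v"
    then show "\<forall>a<N. ?f a j = w a j"
      using block_vec_xi[OF j v j] unfolding u_def w_def by auto
  next
    assume eq: "\<forall>a<N. ?f a j = w a j"
    show "\<xi> j *\<^sub>v v = v"
    proof (rule block_vec_eqI[OF mult_mat_vec_carrier[OF xi_carrier v] v])
      fix p assume p: "1 \<le> p" "p \<le> n"
      show "block_vec N p (\<xi> j *\<^sub>v v) = block_vec N p v"
        by (rule eq_vecI) (use eq[unfolded u_def w_def] block_vec_xi[OF j v p] in auto)
    qed
  qed
  have "(\<forall>j\<in>{1..n}. \<xi> j *\<^sub>v v = v) \<longleftrightarrow> (\<forall>a<N. \<forall>j. 1 \<le> j \<and> j \<le> n \<longrightarrow> ?f a j = w a j)"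
    using fixed by auto
  also have "\<dots> \<longleftrightarrow> (\<forall>a<N. (\<forall>j. 1 \<le> j \<and> j < n \<longrightarrow> w a j = u a (Suc j)) \<and> lam * u a 1 = w a n)"
    by (simp only: telescoped_system[OF n lam])
  also have "\<dots> \<longleftrightarrow> (\<forall>j. 1 \<le> j \<and> j < n \<longrightarrow> (\<forall>a<N. w a j = u a (Suc j))) \<and> (\<forall>a<N. lam * u a 1 = w a n)"
    by blast
  also have "(\<forall>j. 1 \<le> j \<and> j < n \<longrightarrow> (\<forall>a<N. w a j = u a (Suc j))) \<longleftrightarrow>
      (\<forall>j. 1 \<le> j \<and> j < n \<longrightarrow> block_vec N j v = g (Suc j) *\<^sub>v block_vec N (Suc j) v)"
  proof -
    have "block_vec N j v = g (Suc j) *\<^sub>v block_vec N (Suc j) v \<longleftrightarrow> (\<forall>a<N. w a j = u a (Suc j))"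
      if "1 \<le> j" "j < n" for j
      using vec_eq_pointwise[OF block_vec_carrier(1) g_vec[OF _ _ block_vec_carrier(1)], of "Suc j"] that
      unfolding u_def w_def by simp
    then show ?thesis by blast
  qed
  also have "(\<forall>a<N. lam * u a 1 = w a n) \<longleftrightarrow> lam \<cdot>\<^sub>v (g 1 *\<^sub>v block_vec N 1 v) = block_vec N n v"
  proof -
    have c: "g 1 *\<^sub>v block_vec N 1 v \<in> carrier_vec N" using n by simp
    show ?thesis
      using carrier_matD(1)[OF g_mat[of 1]] n
      unfolding u_def w_def vec_eq_pointwise[OF smult_carrier_vec[THEN iffD2, OF c] block_vec_carrier(1)]
      by (simp del: index_mult_mat_vec)
  qed
  finally show ?thesis .
qed

text \<open>
  The product \<open>g\<^sub>j\<^sub>+\<^sub>1 \<cdots> g\<^sub>n\<close>, which expresses block \<open>j\<close> of a common fixed vector by the last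
  block. For \<open>j = n\<close> it is empty and for \<open>j = 0\<close> it is \<open>g\<^sub>1 \<cdots> g\<^sub>n\<close>.
\<close>

definition tail_product :: "nat \<Rightarrow> 'k mat" where
  "tail_product j = list_mult (GL TYPE('k) N) (map g [Suc j..<Suc n])"

lemma tail_product_n: "tail_product n = 1\<^sub>m N"
  by (simp add: tail_product_def list_mult_def)

lemma tail_product_step: "j < n \<Longrightarrow> tail_product j = g (Suc j) * tail_product (Suc j)"
  by (simp add: tail_product_def list_mult_def upt_conv_Cons del: upt_Suc)

lemma tail_product_carrier: "j \<le> n \<Longrightarrow> tail_product j \<in> carrier_mat N N"
proof (induction j rule: inc_induct)
  case (step j)
  then show ?case
    using mult_carrier_mat[OF g_mat[of "Suc j"] step.IH] by (simp add: tail_product_step)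
qed (simp add: tail_product_n)

lemma tail_product_vec:
  "j < n \<Longrightarrow> e \<in> carrier_vec N \<Longrightarrow> tail_product j *\<^sub>v e = g (Suc j) *\<^sub>v (tail_product (Suc j) *\<^sub>v e)"
  using assoc_mult_mat_vec[OF g_mat[of "Suc j"] tail_product_carrier[of "Suc j"], of e]
  by (simp add: tail_product_step)

definition common_fixed :: "'k vec set" where
  "common_fixed = {v \<in> carrier_vec (n * N). \<forall>j\<in>{1..n}. \<xi> j *\<^sub>v v = v}"

definition product_fixed :: "'k vec set" where
  "product_fixed = {e \<in> carrier_vec N. lam \<cdot>\<^sub>v (tail_product 0 *\<^sub>v e) = e}"

context
  assumes n: "1 \<le> n" and lam: "lam \<noteq> 1"
begin

lemma common_fixed_iff:
  "v \<in> common_fixed \<longleftrightarrow> v \<in> carrier_vec (n * N) \<and>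
    (\<forall>j. 1 \<le> j \<and> j < n \<longrightarrow> block_vec N j v = g (Suc j) *\<^sub>v block_vec N (Suc j) v) \<and>
    lam \<cdot>\<^sub>v (g 1 *\<^sub>v block_vec N 1 v) = block_vec N n v"
  using xi_fixed_iff[OF n lam, of v] by (auto simp: common_fixed_def)

lemma common_fixed_block:
  assumes v: "v \<in> common_fixed" and j: "1 \<le> j" "j \<le> n"
  shows "block_vec N j v = tail_product j *\<^sub>v block_vec N n v"
  using j(2,1)
proof (induction j rule: inc_induct)
  case (step j)
  then show ?case
    using v by (simp add: common_fixed_iff tail_product_vec)
qed (simp add: tail_product_n)

lemma common_fixed_last:
  assumes v: "v \<in> common_fixed"
  shows "block_vec N n v \<in> product_fixed"
proof -
  have "tail_product 0 *\<^sub>v block_vec N n v = g 1 *\<^sub>v block_vec N 1 v"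
    using tail_product_vec[of 0 "block_vec N n v"] common_fixed_block[OF v, of 1] n by simp
  then show ?thesis using v by (simp add: product_fixed_def common_fixed_iff)
qed

text \<open>
  The inverse sends \<open>e\<close> to the vector with blocks \<open>g\<^sub>j\<^sub>+\<^sub>1 \<cdots> g\<^sub>n e\<close>.
\<close>

lemma bij_betw_last_block: "bij_betw (block_vec N n) common_fixed product_fixed"
proof (rule bij_betw_imageI)
  show "inj_on (block_vec N n) common_fixed"
  proof (rule inj_onI)
    fix v w assume v: "v \<in> common_fixed" and w: "w \<in> common_fixed" and eq: "block_vec N n v = block_vec N n w"
    show "v = w"
    proof (rule block_vec_eqI)
      fix p assume "1 \<le> p" "p \<le> n"
      then show "block_vec N p v = block_vec N p w"
        using common_fixed_block[OF v, of p] common_fixed_block[OF w, of p] eq by simp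
    qed (use v w in \<open>auto simp: common_fixed_def\<close>)
  qed
  show "block_vec N n ` common_fixed = product_fixed"
  proof (intro equalityI subsetI)
    fix e assume e: "e \<in> product_fixed"
    then have e': "e \<in> carrier_vec N" by (simp add: product_fixed_def)
    define v where "v = concat_blocks n N (\<lambda>j. tail_product j *\<^sub>v e)"
    have bv: "block_vec N j v = tail_product j *\<^sub>v e" if "1 \<le> j" "j \<le> n" for j
      unfolding v_def
      by (rule block_vec_concat_blocks[OF that])
        (rule mult_mat_vec_carrier[OF tail_product_carrier[OF that(2)] e'])
    have "block_vec N n v = e" using bv[of n] n e' by (simp add: tail_product_n)
    moreover have "v \<in> common_fixed"
      using e e' n bv tail_product_vec[of 0 e]
      by (simp add: common_fixed_iff bv tail_product_vec tail_product_n product_fixed_def) (simp add: v_def)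
    ultimately show "e \<in> block_vec N n ` common_fixed" by blast
  qed (use common_fixed_last in blast)
qed

text \<open>
  Write \<open>w\<close> for the image of \<open>v = (x\<^sub>1, \<dots>, x\<^sub>n)\<close>. Since \<open>x\<^sub>i = g\<^sub>i\<^sub>+\<^sub>1 x\<^sub>i\<^sub>+\<^sub>1\<close>, its blocks are
  \<open>w\<^sub>j = s\<^sub>i x\<^sub>j\<close> except for \<open>w\<^sub>i = s\<^sub>i g\<^sub>i x\<^sub>i\<^sub>+\<^sub>1\<close>. The identity \<open>g\<^sub>j w\<^sub>j = s\<^sub>i g\<^sub>j x\<^sub>j\<close>, valid for
  \<open>j \<noteq> i + 1\<close>, then transports every equation satisfied by \<open>v\<close> to \<open>w\<close>, except \<open>w\<^sub>i = g\<^sub>i\<^sub>+\<^sub>1 w\<^sub>i\<^sub>+\<^sub>1\<close>,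
  which is the relation \<open>s\<^sub>i g\<^sub>i = g\<^sub>i\<^sub>+\<^sub>1 s\<^sub>i\<close>.
\<close>

lemma sigma_common_fixed:
  assumes i: "1 \<le> i" "i < n" and v: "v \<in> common_fixed"
  shows "\<sigma> i *\<^sub>v v \<in> common_fixed"
    and "block_vec N n (\<sigma> i *\<^sub>v v) = s i *\<^sub>v block_vec N n v"
proof -
  define x where "x j = block_vec N j v" for j
  define w where "w j = block_vec N j (\<sigma> i *\<^sub>v v)" for j
  have vc: "v \<in> carrier_vec (n * N)" using v by (simp add: common_fixed_def)
  have xc [simp]: "x j \<in> carrier_vec N" for j by (simp add: x_def)
  have x: "x j = g (Suc j) *\<^sub>v x (Suc j)" if "1 \<le> j" "j < n" for j
    using v that by (simp add: common_fixed_iff x_def)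
  have x_last: "lam \<cdot>\<^sub>v (g 1 *\<^sub>v x 1) = x n" using v by (simp add: common_fixed_iff x_def)
  have w: "w j = (if j = i then s i *\<^sub>v (g i *\<^sub>v x (Suc i)) else s i *\<^sub>v x j)" if "1 \<le> j" "j \<le> n" for j
  proof -
    have "x i + (x (Suc i) - g (Suc i) *\<^sub>v x (Suc i)) = x (Suc i)"
      using x[OF i, symmetric] by (simp, intro eq_vecI) (auto simp: x_def)
    then show ?thesis using block_vec_sigma[OF i vc that] by (simp add: w_def x_def)
  qed
  have gw: "g j *\<^sub>v w j = s i *\<^sub>v (g j *\<^sub>v x j)" if j: "1 \<le> j" "j \<le> n" "j \<noteq> Suc i" for j
  proof (cases "j = i")
    case True
    have "g i *\<^sub>v w i = g i *\<^sub>v (g (Suc i) *\<^sub>v (s i *\<^sub>v x (Suc i)))"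
      using w[of i] i by (simp add: s_g_vec)
    also have "\<dots> = g (Suc i) *\<^sub>v (s i *\<^sub>v (g (Suc i) *\<^sub>v x (Suc i)))"
      using i by (simp add: s_g_Suc_vec)
    also have "\<dots> = s i *\<^sub>v (g i *\<^sub>v x i)"
      using i x[OF i] by (simp add: s_g_vec)
    finally show ?thesis using True by simp
  next
    case False
    then show ?thesis using w[OF j(1,2)] s_g_other_vec[OF xc i j(1,2)] j by simp
  qed
  show last: "block_vec N n (\<sigma> i *\<^sub>v v) = s i *\<^sub>v block_vec N n v"
    using w[of n] i by (simp add: w_def x_def)
  have "w j = g (Suc j) *\<^sub>v w (Suc j)" if j: "1 \<le> j" "j < n" for j
  proof (cases "j = i")
    case True
    then show ?thesis using w[of i] w[of "Suc i"] i by (simp add: s_g_vec)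
  next
    case False
    then show ?thesis using gw[of "Suc j"] w[of j] x[OF j] j by simp
  qed
  moreover have "lam \<cdot>\<^sub>v (g 1 *\<^sub>v w 1) = w n"
  proof -
    have g1: "g 1 *\<^sub>v x 1 \<in> carrier_vec N" using n by simp
    have "lam \<cdot>\<^sub>v (g 1 *\<^sub>v w 1) = s i *\<^sub>v (lam \<cdot>\<^sub>v (g 1 *\<^sub>v x 1))"
      using gw[of 1] mult_mat_vec[OF s_mat[OF i] g1, of lam] n i by simp
    then show ?thesis using last x_last by (simp add: w_def x_def)
  qed
  ultimately show "\<sigma> i *\<^sub>v v \<in> common_fixed"
    using sigma_vec[OF i vc] by (simp add: common_fixed_iff w_def)
qed

end

end

section \<open>Matrices of restrictions to invariant subspaces\<close>

lemma subspace_vecI: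
  fixes W :: "'k :: field vec set"
  assumes "W \<subseteq> carrier_vec m" "0\<^sub>v m \<in> W"
    and "\<And>v w. v \<in> W \<Longrightarrow> w \<in> W \<Longrightarrow> v + w \<in> W" "\<And>c v. v \<in> W \<Longrightarrow> c \<cdot>\<^sub>v v \<in> W"
  shows "subspace class_ring W (module_vec TYPE('k) m)"
proof -
  interpret vec_space "TYPE('k)" m .
  show ?thesis
    by (intro subspace.intro submodule.intro)
      (use assms vectorspace_axioms module_axioms in \<open>auto simp: module_vec_simps\<close>)
qed

lemma fixed_vectors_kernel:
  fixes A :: "'k :: field mat"
  assumes A: "A \<in> carrier_mat m m"
  shows "mat_kernel (A - 1\<^sub>m m) = {v \<in> carrier_vec m. A *\<^sub>v v = v}"
proof -
  have "(A - 1\<^sub>m m) *\<^sub>v v = 0\<^sub>v m \<longleftrightarrow> A *\<^sub>v v = v" if v: "v \<in> carrier_vec m" for v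
  proof -
    have Av: "A *\<^sub>v v \<in> carrier_vec m" using A v by simp
    have "(A - 1\<^sub>m m) *\<^sub>v v = A *\<^sub>v v - v"
      using minus_mult_distrib_mat_vec[OF A one_carrier_mat v] v by simp
    moreover have "A *\<^sub>v v - v = 0\<^sub>v m \<longleftrightarrow> A *\<^sub>v v = v"
    proof
      assume z: "A *\<^sub>v v - v = 0\<^sub>v m"
      show "A *\<^sub>v v = v"
      proof (rule eq_vecI)
        fix a assume a: "a < dim_vec v"
        have "(A *\<^sub>v v - v) $ a = 0" using z a v by simp
        then show "(A *\<^sub>v v) $ a = v $ a" using a by simp
      qed (use A v in auto)
    qed (use v in simp)
    ultimately show ?thesis by simp
  qed
  then show ?thesis using mat_kernel[OF minus_carrier_mat[OF one_carrier_mat]] by auto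
qed

lemma subspace_fixed_vectors:
  fixes As :: "'k :: field mat set"
  assumes As: "As \<subseteq> carrier_mat m m"
  shows "subspace class_ring {v \<in> carrier_vec m. \<forall>A\<in>As. A *\<^sub>v v = v} (module_vec TYPE('k) m)"
proof (rule subspace_vecI)
  have "A *\<^sub>v 0\<^sub>v m = 0\<^sub>v m" if "A \<in> As" for A using As that by (intro eq_vecI) auto
  then show "0\<^sub>v m \<in> {v \<in> carrier_vec m. \<forall>A\<in>As. A *\<^sub>v v = v}" by simp
qed (use As in \<open>auto simp: mult_add_distrib_mat_vec[of _ m m] mult_mat_vec[of _ m m] subset_iff\<close>)

lemma linear_map_subspaceI:
  fixes W U :: "'k :: field vec set"
  assumes W: "subspace class_ring W (module_vec TYPE('k) m)" and U: "subspace class_ring U (module_vec TYPE('k) d)"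
    and Q: "Q \<in> carrier_mat d m" and f: "\<And>w. w \<in> W \<Longrightarrow> f w = Q *\<^sub>v w" "f ` W \<subseteq> U"
  shows "linear_map class_ring (subspace_of m W) (subspace_of d U) f"
proof -
  interpret V: vec_space "TYPE('k)" m .
  interpret V': vec_space "TYPE('k)" d .
  have vs: "vectorspace class_ring (subspace_of m W)" "vectorspace class_ring (subspace_of d U)"
    using V.subspace_is_vs[OF W] V'.subspace_is_vs[OF U] by (simp_all add: subspace_of_def)
  have W': "submodule class_ring W (module_vec TYPE('k) m)" using W by (simp add: subspace_def)
  have Wc: "W \<subseteq> carrier_vec m" using submodule.subset[OF W'] by (simp add: module_vec_simps)
  have "f \<in> module_hom class_ring (subspace_of m W) (subspace_of d U)"
    unfolding module_hom_def
  proof (intro CollectI conjI allI impI)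
    show "f \<in> carrier (subspace_of m W) \<rightarrow> carrier (subspace_of d U)"
      using f(2) by (auto simp: subspace_of_def)
    fix v w assume "v \<in> carrier (subspace_of m W) \<and> w \<in> carrier (subspace_of m W)"
    then have vw: "v \<in> W" "w \<in> W" by (simp_all add: subspace_of_def)
    have "v + w \<in> W" using submodule.m_closed[OF W' vw] by (simp add: module_vec_simps)
    then show "f (v \<oplus>\<^bsub>subspace_of m W\<^esub> w) = f v \<oplus>\<^bsub>subspace_of d U\<^esub> f w"
      using vw Wc f(1) mult_add_distrib_mat_vec[OF Q, of v w]
      by (auto simp: subspace_of_def module_vec_simps subset_iff)
  next
    fix c :: 'k and w assume "c \<in> carrier class_ring \<and> w \<in> carrier (subspace_of m W)"
    then have w: "w \<in> W" by (simp add: subspace_of_def)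
    have "c \<cdot>\<^sub>v w \<in> W" using submodule.smult_closed[OF W' _ w, of c] by (simp add: module_vec_simps class_ring_simps)
    then show "f (c \<odot>\<^bsub>subspace_of m W\<^esub> w) = c \<odot>\<^bsub>subspace_of d U\<^esub> f w"
      using w Wc f(1) mult_mat_vec[OF Q, of w c]
      by (auto simp: subspace_of_def module_vec_simps subset_iff)
  qed
  then show ?thesis
    using vs by (simp add: linear_map_def mod_hom_def mod_hom_axioms_def vectorspace_def)
qed

text \<open>
  If \<open>P\<close> has the chosen basis of \<open>W\<close> as columns, then \<open>Q P\<close> has the image basis of \<open>U\<close> as columns, and
  \<open>B Q P = Q A P = Q P M\<close>. Representing the isomorphism by a matrix \<open>Q\<close> reduces the
  claim to associativity.
\<close>

lemma is_restr_mat_transport: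
  fixes W U :: "'k :: field vec set"
  assumes W: "subspace class_ring W (module_vec TYPE('k) m)" and U: "subspace class_ring U (module_vec TYPE('k) d)"
    and Q: "Q \<in> carrier_mat d m" and f: "\<And>w. w \<in> W \<Longrightarrow> f w = Q *\<^sub>v w" and bij: "bij_betw f W U"
    and A: "A \<in> carrier_mat m m" and B: "B \<in> carrier_mat d d"
    and inter: "\<And>w. w \<in> W \<Longrightarrow> A *\<^sub>v w \<in> W \<and> f (A *\<^sub>v w) = B *\<^sub>v f w"
    and M: "is_restr_mat m A W M"
  shows "is_restr_mat d B U M"
proof -
  obtain bs where bs: "distinct bs" "set bs \<subseteq> W" "vectorspace.basis class_ring (subspace_of m W) (set bs)"
    and Mc: "M \<in> carrier_mat (length bs) (length bs)" and AM: "A * mat_of_cols m bs = mat_of_cols m bs * M"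
    using M unfolding is_restr_mat_def by auto
  interpret f: linear_map class_ring "subspace_of m W" "subspace_of d U" f
    by (rule linear_map_subspaceI[OF W U Q f]) (use bij in \<open>auto simp: bij_betw_def\<close>)
  have carr: "carrier (subspace_of m W) = W" "carrier (subspace_of d U) = U" by (simp_all add: subspace_of_def)
  have "f.V.fin_dim"
    using bs(3) unfolding f.V.fin_dim_def f.V.basis_def by (intro exI[of _ "set bs"]) auto
  then have basis: "vectorspace.basis class_ring (subspace_of d U) (set (map f bs))"
    using f.linear_inj_image_is_basis[of "set bs"] bs(3) bij by (simp add: carr bij_betw_def)
  have Wc: "W \<subseteq> carrier_vec m" using W by (auto simp: subspace_def dest!: submodule.subset simp: module_vec_simps)
  let ?P = "mat_of_cols m bs" and ?P' = "mat_of_cols d (map f bs)"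
  have P: "?P \<in> carrier_mat m (length bs)" and P': "?P' \<in> carrier_mat d (length bs)"
    using mat_of_cols_carrier(1)[of d "map f bs"] by simp_all
  have bsW: "bs ! j \<in> W" "bs ! j \<in> carrier_vec m" if "j < length bs" for j
    using nth_mem[OF that] bs(2) Wc by auto
  have fc: "f w \<in> carrier_vec d" if "w \<in> W" for w
    using that f Q Wc by auto
  have colP: "col ?P j = bs ! j" and colP': "col ?P' j = f (bs ! j)" if "j < length bs" for j
    using that bsW fc by (auto simp: col_mat_of_cols)
  have QP: "Q * ?P = ?P'"
  proof (rule mat_col_eqI)
    fix j assume "j < dim_col ?P'"
    then have j: "j < length bs" by simp
    show "col (Q * ?P) j = col ?P' j"
      using col_mult2[OF Q P j] bsW[OF j] by (simp add: colP[OF j] colP'[OF j] f)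
  qed (use Q in auto)
  have "B * ?P' = Q * (A * ?P)"
  proof (rule mat_col_eqI)
    fix j assume "j < dim_col (Q * (A * ?P))"
    then have j: "j < length bs" by simp
    have AP: "A * ?P \<in> carrier_mat m (length bs)" using A P by simp
    show "col (B * ?P') j = col (Q * (A * ?P)) j"
      using col_mult2[OF B P' j] col_mult2[OF Q AP j] col_mult2[OF A P j] inter[OF bsW(1)[OF j]]
      by (simp add: colP[OF j] colP'[OF j] f[symmetric])
  qed (use Q B in auto)
  also have "\<dots> = ?P' * M"
    using assoc_mult_mat[OF Q P Mc] by (simp add: AM QP)
  finally have "B * ?P' = ?P' * M" .
  then show ?thesis
    unfolding is_restr_mat_def
    using bs bij basis Mc
    by (intro exI[of _ "map f bs"]) (auto simp: bij_betw_def distinct_map inj_on_subset)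
qed

text \<open>
  The columns are completed to a basis of the whole space; the first rows of the inverse of the
  resulting square matrix form a left inverse.
\<close>

lemma independent_columns_left_inverse:
  fixes bs :: "'k :: field vec list"
  assumes d: "distinct bs" and c: "set bs \<subseteq> carrier_vec m"
    and li: "LinearCombinations.module.lin_indpt class_ring (module_vec TYPE('k) m) (set bs)"
  shows "\<exists>Q \<in> carrier_mat (length bs) m. Q * mat_of_cols m bs = 1\<^sub>m (length bs)"
proof -
  interpret vec_space "TYPE('k)" m .
  define I where "I S \<longleftrightarrow> S \<subseteq> carrier_vec m \<and> lin_indpt S \<and> set bs \<subseteq> S" for S
  have fin: "finite S \<and> card S \<le> m" if "I S" for S
    using that li_le_dim[OF fin_dim, of S] fin_dim_li_fin[OF fin_dim, of S] dim_is_n unfolding I_def by auto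
  have I_bs: "I (set bs)" using c li by (simp add: I_def)
  obtain S where S: "finite S" "maximal S I"
    using maximal_exists[where P = I and N = m and B = "set bs", OF fin I_bs] by blast
  have IS: "I S" using S(2) by (simp add: maximal_def)
  have "maximal S (\<lambda>S. S \<subseteq> carrier V \<and> lin_indpt S)"
    unfolding maximal_def
  proof (intro conjI allI impI)
    fix T assume T: "S \<subseteq> T \<and> T \<subseteq> carrier V \<and> lin_indpt T"
    then have "I T" using IS by (auto simp: I_def module_vec_simps)
    then show "T = S" using S(2) T unfolding maximal_def by blast
  qed (use IS in \<open>simp_all add: I_def module_vec_simps\<close>)
  then have bas: "basis S" using vectorspace.max_li_is_basis[OF vectorspace_axioms] by blast
  have cardS: "card S = m" using dim_basis[OF S(1) bas] dim_is_n by simp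
  obtain cs where cs: "set cs = S - set bs" "distinct cs" using finite_distinct_list[of "S - set bs"] S(1) by auto
  let ?xs = "bs @ cs"
  have xs: "set ?xs = S" "distinct ?xs" using cs d IS by (auto simp: I_def)
  then have len: "length ?xs = m" using cardS distinct_card by metis
  let ?R = "mat_of_cols m ?xs" and ?P = "mat_of_cols m bs"
  have R: "?R \<in> carrier_mat m m" using mat_of_cols_carrier(1)[of m ?xs] len by simp
  have cols: "cols ?R = ?xs" using xs(1) IS by (intro cols_mat_of_cols) (auto simp: I_def)
  have "det ?R \<noteq> 0"
  proof
    assume "det ?R = 0"
    then obtain v where "v \<in> carrier_vec m" "v \<noteq> 0\<^sub>v m" "?R *\<^sub>v v = 0\<^sub>v m"
      using det_0_iff_vec_prod_zero_field[OF R] by auto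
    from lin_depI[OF R this] show False using IS xs by (simp add: cols I_def)
  qed
  then obtain Ri where Ri: "Ri \<in> carrier_mat m m" "Ri * ?R = 1\<^sub>m m"
    using det_non_zero_imp_unit[OF R, of "()"] by (auto simp: Units_def ring_mat_simps)
  let ?l = "length bs"
  have l: "?l \<le> m" using len by simp
  define Q where "Q = mat ?l m (\<lambda>(i, j). Ri $$ (i, j))"
  have "Q * ?P = 1\<^sub>m ?l"
  proof (rule eq_matI)
    fix i j assume "i < dim_row (1\<^sub>m ?l :: 'k mat)" "j < dim_col (1\<^sub>m ?l :: 'k mat)"
    then have ij: "i < ?l" "j < ?l" by simp_all
    have "col ?P j = col ?R j"
      by (rule eq_vecI) (use ij l in \<open>auto simp: mat_of_cols_index nth_append\<close>)
    moreover have "row Q i = row Ri i"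
      by (rule eq_vecI) (use ij l Ri(1) in \<open>auto simp: Q_def\<close>)
    moreover have "row Ri i \<bullet> col ?R j = (Ri * ?R) $$ (i, j)"
      using ij l Ri(1) R len by simp
    ultimately show "(Q * ?P) $$ (i, j) = 1\<^sub>m ?l $$ (i, j)"
      using ij l by (simp add: Ri(2) Q_def)
  qed (auto simp: Q_def)
  moreover have "Q \<in> carrier_mat ?l m" by (simp add: Q_def)
  ultimately show ?thesis by blast
qed

interpretation to_ac: field_hom "to_ac :: 'k :: field \<Rightarrow> 'k alg_closure"
  by unfold_locales simp_all

text \<open>
  Independence of the columns of \<open>P\<close> over \<open>k\<close> has to be carried over to the algebraic closure. In the
  form of an equation \<open>Q P = 1\<close> it is preserved by every homomorphism of fields.
\<close>

lemma ac_spectrum_restr_mat: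
  fixes B :: "'k :: field mat"
  assumes U: "subspace class_ring U (module_vec TYPE('k) d)" and B: "B \<in> carrier_mat d d"
    and M: "is_restr_mat d B U M"
  shows "ac_spectrum M \<subseteq> ac_spectrum B"
proof
  fix \<mu> assume "\<mu> \<in> ac_spectrum M"
  obtain bs where bs: "distinct bs" "set bs \<subseteq> U" "vectorspace.basis class_ring (subspace_of d U) (set bs)"
    and Mc: "M \<in> carrier_mat (length bs) (length bs)" and BM: "B * mat_of_cols d bs = mat_of_cols d bs * M"
    using M unfolding is_restr_mat_def by auto
  interpret vec_space "TYPE('k)" d .
  have U': "submodule class_ring U V" using U by (simp add: subspace_def)
  have vsU: "vectorspace class_ring (vs U)" using U by (rule subspace_is_vs)
  have li: "lin_indpt (set bs)"
    using bs(3) span_li_not_depend[OF bs(2) U'] unfolding subspace_of_def vectorspace.basis_def[OF vsU] by auto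
  let ?P = "mat_of_cols d bs" and ?l = "length bs"
  have P: "?P \<in> carrier_mat d ?l" by simp
  obtain Q where Q: "Q \<in> carrier_mat ?l d" "Q * ?P = 1\<^sub>m ?l"
    using independent_columns_left_inverse[OF bs(1) basis_coordinates(1)[OF U bs] li] by blast
  let ?h = "map_mat (to_ac :: 'k \<Rightarrow> 'k alg_closure)"
  have hP: "?h ?P \<in> carrier_mat d ?l" and hQ: "?h Q \<in> carrier_mat ?l d" and hM: "?h M \<in> carrier_mat ?l ?l"
    and hB: "?h B \<in> carrier_mat d d"
    using P Q Mc B by auto
  have hQP: "?h Q * ?h ?P = 1\<^sub>m ?l"
    using to_ac.mat_hom_mult[OF Q(1) P] Q(2) to_ac.mat_hom_one by metis
  have hBP: "?h B * ?h ?P = ?h ?P * ?h M"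
    using to_ac.mat_hom_mult[OF B P] to_ac.mat_hom_mult[OF P Mc] BM by simp
  from \<open>\<mu> \<in> ac_spectrum M\<close> obtain x where x: "x \<in> carrier_vec ?l" "x \<noteq> 0\<^sub>v ?l" "?h M *\<^sub>v x = \<mu> \<cdot>\<^sub>v x"
    using Mc by (auto simp: ac_spectrum_def spectrum_def eigenvalue_def eigenvector_def)
  let ?y = "?h ?P *\<^sub>v x"
  have y: "?y \<in> carrier_vec d" by (rule mult_mat_vec_carrier[OF hP x(1)])
  have "?h Q *\<^sub>v ?y = x" using assoc_mult_mat_vec[OF hQ hP x(1)] hQP x(1) by simp
  moreover have "?h Q *\<^sub>v 0\<^sub>v d = 0\<^sub>v ?l" using hQ by (intro eq_vecI) auto
  ultimately have "?y \<noteq> 0\<^sub>v d" using x(2) by metis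
  moreover have "?h B *\<^sub>v ?y = \<mu> \<cdot>\<^sub>v ?y"
    using assoc_mult_mat_vec[OF hB hP x(1)] assoc_mult_mat_vec[OF hP hM x(1)] hBP x(3) mult_mat_vec[OF hP x(1)]
    by simp
  ultimately show "\<mu> \<in> ac_spectrum B"
    using y B unfolding ac_spectrum_def spectrum_def eigenvalue_def eigenvector_def by auto
qed

section \<open>The fixed space of the twisted Long--Moody representation\<close>

lemma smult_mat_mult_vec:
  fixes A :: "'k :: field mat"
  assumes "A \<in> carrier_mat m d" "v \<in> carrier_vec d"
  shows "(c \<cdot>\<^sub>m A) *\<^sub>v v = c \<cdot>\<^sub>v (A *\<^sub>v v)"
  by (rule eq_vecI) (use assms in \<open>auto simp: row_smult\<close>)

definition block_projection :: "nat \<Rightarrow> nat \<Rightarrow> nat \<Rightarrow> 'k :: field mat" where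
  "block_projection n N p = mat N (n * N) (\<lambda>(a, b). if b = (p - 1) * N + a then 1 else 0)"

lemma block_projection_carrier: "block_projection n N p \<in> carrier_mat N (n * N)"
  by (simp add: block_projection_def)

lemma block_vec_projection:
  assumes p: "1 \<le> p" "p \<le> n" and v: "v \<in> carrier_vec (n * N)"
  shows "block_vec N p v = block_projection n N p *\<^sub>v v"
proof (rule eq_vecI)
  fix a assume "a < dim_vec (block_projection n N p *\<^sub>v v)"
  then have a: "a < N" by (simp add: block_projection_def)
  have r: "(p - 1) * N + a < n * N" using block_index_less[OF p a] .
  have "(block_projection n N p *\<^sub>v v) $ a =
      (\<Sum>b\<in>{0..<n * N}. (if b = (p - 1) * N + a then 1 else 0) * v $ b)"
    using a v by (simp add: block_projection_def scalar_prod_def)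
  also have "\<dots> = (\<Sum>b\<in>{0..<n * N}. if b = (p - 1) * N + a then v $ b else 0)"
    by (rule sum.cong) auto
  also have "\<dots> = block_vec N p v $ a" using r a by (simp add: block_vec_index)
  finally show "block_vec N p v $ a = (block_projection n N p *\<^sub>v v) $ a" by simp
qed (simp add: block_projection_def)

context long_moody_data
begin

text \<open>
  Because the relations have been verified, the Long--Moody representation takes the prescribed
  values on the generators of both factors.
\<close>

lemma long_moody_generators:
  assumes g: "g = (\<lambda>j. rho (fb_x n j))" and s: "s = (\<lambda>i. rho (fb_sigma n i))"
  shows long_moody_fb_x: "1 \<le> j \<Longrightarrow> j \<le> n \<Longrightarrow> long_moody n N rho lam (fb_x n j) = \<xi> j"
    and long_moody_fb_sigma: "1 \<le> i \<Longrightarrow> i < n \<Longrightarrow> long_moody n N rho lam (fb_sigma n i) = \<sigma> i"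
proof -
  interpret x: presentation_hom "{1..n}" "{}" "GL TYPE('k) (n * N)" \<xi>
    by (rule presentation_hom_free[OF group_GL]) (simp add: xi_GL)
  interpret b: presentation_hom "{1..<n}" "braid_relations n" "GL TYPE('k) (n * N)" \<sigma>
    by (rule presentation_hom_braid[OF group_GL], unfold GL_mult)
      (rule sigma_GL sigma_adjacent sigma_far; assumption)+
  have lm: "long_moody n N rho lam = (\<lambda>(x, b). pres_lift (GL TYPE('k) (n * N)) \<xi> x
      \<otimes>\<^bsub>GL TYPE('k) (n * N)\<^esub> pres_lift (GL TYPE('k) (n * N)) \<sigma> b)"
    by (simp only: long_moody_def g s)
  show "long_moody n N rho lam (fb_x n j) = \<xi> j" if "1 \<le> j" "j \<le> n"
    using x.pres_lift_gen[of j] b.pres_lift_one that right_mult_one_mat[OF xi_carrier]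
    by (simp add: lm fb_x_def free_gen_def braid_group_def)
  show "long_moody n N rho lam (fb_sigma n i) = \<sigma> i" if "1 \<le> i" "i < n"
    using b.pres_lift_gen[of i] x.pres_lift_one that left_mult_one_mat[OF sigma_carrier[OF that]]
    by (simp add: lm fb_sigma_def braid_gen_def free_group_def)
qed

end

theorem lemma5p2:
  fixes n N i :: nat
    and rho :: "nat word set \<times> nat word set \<Rightarrow> 'k :: field mat"
    and lam :: 'k
    and g s :: "nat \<Rightarrow> 'k mat"
    and S G :: "'k mat"
    and L E :: "'k vec set"
  assumes "n \<ge> 2"
    and "rho \<in> hom (free_braid n) (GL TYPE('k) N)"
    and "lam \<noteq> 0" and "lam \<noteq> 1"
    and "1 \<le> i" and "i \<le> n - 1"
    and g_def: "\<And>j. g j = rho (fb_x n j)"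
    and s_def: "\<And>j. s j = rho (fb_sigma n j)"
    and S_def: "S = long_moody n N rho lam (fb_sigma n i)"
    and L_def: "L = lm_fixed n N rho lam"
    and G_def: "G = list_mult (GL TYPE('k) N) (map g [1..<Suc n])"
    and E_def: "E = mat_kernel (lam \<cdot>\<^sub>m G - 1\<^sub>m N)"
  shows "artin_action n (braid_gen n i) (list_mult (free_group n) (map (free_gen n) [1..<Suc n]))
           = list_mult (free_group n) (map (free_gen n) [1..<Suc n]) \<and>
         s i * G = G * s i \<and>
         (\<forall>v\<in>E. s i *\<^sub>v v \<in> E) \<and>
         (\<forall>v\<in>L. S *\<^sub>v v \<in> L) \<and>
         linear_map class_ring (subspace_of (n * N) L) (subspace_of N E) (block_vec N n) \<and>
         bij_betw (block_vec N n) L E \<and>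
         (\<forall>v\<in>L. block_vec N n (S *\<^sub>v v) = s i *\<^sub>v block_vec N n v) \<and>
         char_poly (restr_mat (n * N) S L) = char_poly (restr_mat N (s i) E) \<and>
         ac_spectrum (restr_mat (n * N) S L) \<subseteq> ac_spectrum (s i)"
proof -
  have n: "1 \<le> n" and i: "1 \<le> i" "i < n" using assms(1,5,6) by auto
  have g: "g = (\<lambda>j. rho (fb_x n j))" by (rule ext) (rule g_def)
  have s: "s = (\<lambda>j. rho (fb_sigma n j))" by (rule ext) (rule s_def)
  note rel = free_braid_hom_relations[OF group_GL assms(2), folded g_def s_def, unfolded GL_mult]
  interpret long_moody_data n N g s lam
    by (rule long_moody_data.intro) (rule assms(3) | (rule rel; assumption))+
  let ?p = "list_mult (free_group n) (map (free_gen n) [1..<Suc n])"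
  have product: "artin_action n (braid_gen n i) ?p = ?p"
    using artin_generator.artin_gen_product[OF artin_generator.intro[OF i]] artin_action_gen[OF i] by simp
  have G: "G = tail_product 0" by (simp add: G_def tail_product_def)
  have Gc: "G \<in> carrier_mat N N" using tail_product_carrier[of 0] by (simp add: G)
  have comm: "s i * G = G * s i"
    using sigma_product[OF group_GL assms(2) i] by (simp only: GL_mult G_def g s)
  have lG: "lam \<cdot>\<^sub>m G \<in> carrier_mat N N" using Gc by simp
  have E_fixed: "E = {v \<in> carrier_vec N. \<forall>A\<in>{lam \<cdot>\<^sub>m G}. A *\<^sub>v v = v}"
    using fixed_vectors_kernel[OF lG] by (simp add: E_def)
  have E: "E = product_fixed"
    unfolding E_fixed product_fixed_def using smult_mat_mult_vec[OF Gc] by (auto simp: G)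
  have L_fixed: "L = {v \<in> carrier_vec (n * N). \<forall>A\<in>\<xi> ` {1..n}. A *\<^sub>v v = v}"
  proof -
    have "L = (\<Inter>j\<in>{1..n}. {v \<in> carrier_vec (n * N). \<xi> j *\<^sub>v v = v})"
      unfolding L_def lm_fixed_def
      by (rule INF_cong)
        (simp_all add: long_moody_fb_x[OF g s] fixed_vectors_kernel[OF xi_carrier])
    then show ?thesis using n by auto
  qed
  have L: "L = common_fixed" unfolding L_fixed common_fixed_def by simp
  have S: "S = \<sigma> i" unfolding S_def by (rule long_moody_fb_sigma[OF g s i])
  have subL: "subspace class_ring L (module_vec TYPE('k) (n * N))"
    unfolding L_fixed by (rule subspace_fixed_vectors) auto
  have subE: "subspace class_ring E (module_vec TYPE('k) N)"
    unfolding E_fixed by (rule subspace_fixed_vectors) (use lG in simp)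
  have s_E: "\<forall>v\<in>E. s i *\<^sub>v v \<in> E"
  proof
    fix v assume "v \<in> E"
    then have v: "v \<in> carrier_vec N" "lam \<cdot>\<^sub>v (G *\<^sub>v v) = v" by (auto simp: E product_fixed_def G)
    have "G *\<^sub>v (s i *\<^sub>v v) = s i *\<^sub>v (G *\<^sub>v v)"
      using assoc_mult_mat_vec[OF Gc s_mat[OF i] v(1)] assoc_mult_mat_vec[OF s_mat[OF i] Gc v(1)] comm by simp
    then have "lam \<cdot>\<^sub>v (G *\<^sub>v (s i *\<^sub>v v)) = s i *\<^sub>v v"
      using mult_mat_vec[OF s_mat[OF i] mult_mat_vec_carrier[OF Gc v(1)], of lam] v(2) by simp
    then show "s i *\<^sub>v v \<in> E" using v(1) i by (simp add: E product_fixed_def G)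
  qed
  have S_L: "S *\<^sub>v v \<in> L" and last_S: "block_vec N n (S *\<^sub>v v) = s i *\<^sub>v block_vec N n v" if "v \<in> L" for v
    using sigma_common_fixed[OF n assms(4) i] that by (simp_all add: L S)
  have bij: "bij_betw (block_vec N n) L E"
    using bij_betw_last_block[OF n assms(4)] by (simp add: L E)
  note Q = block_projection_carrier[of n N n]
  have last: "block_vec N n v = block_projection n N n *\<^sub>v v" if "v \<in> L" for v
    by (rule block_vec_projection[OF n order.refl]) (use that in \<open>simp add: L_fixed\<close>)
  have lin: "linear_map class_ring (subspace_of (n * N) L) (subspace_of N E) (block_vec N n)"
    by (rule linear_map_subspaceI[OF subL subE Q last]) (use bij in \<open>auto simp: bij_betw_def\<close>)
  have Sc: "S \<in> carrier_mat (n * N) (n * N)" using sigma_carrier[OF i] by (simp add: S)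
  have M: "is_restr_mat (n * N) S L (restr_mat (n * N) S L)"
    unfolding restr_mat_def using is_restr_mat_exists[OF Sc subL S_L] by (rule someI_ex)
  \<comment> \<open>The same matrix serves on both sides, so no similarity argument is needed for the spectra.\<close>
  have M': "is_restr_mat N (s i) E (restr_mat (n * N) S L)"
    by (rule is_restr_mat_transport[OF subL subE Q last bij Sc s_mat[OF i] _ M]) (use S_L last_S in auto)
  have chi: "char_poly (restr_mat (n * N) S L) = char_poly (restr_mat N (s i) E)"
    using char_poly_restr_mat[OF s_mat[OF i] subE M'] by simp
  have spec: "ac_spectrum (restr_mat (n * N) S L) \<subseteq> ac_spectrum (s i)"
    by (rule ac_spectrum_restr_mat[OF subE s_mat[OF i] M'])
  show ?thesis
    using product comm s_E S_L last_S lin bij chi spec by blast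
qed

end
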